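(* Every polynomial of degree three in $\mathbb{R}[x,y]$ is equivalent with respect to $\sim$ to some polynomial in the list $\mathcal{L}$. Moreover, the polynomials in $\mathcal{L}$ are pairwise inequivalent with respect to $\sim$ (i.e. no two distinct polynomials in $\mathcal{L}$ are equivalent with respect to $\sim$).
   Context: $\Gamma_2(\mathbb{R})$ denotes the affine group: the group of ring automorphisms $\theta$ of $\mathbb{R}[x,y]$ such that $\theta(x)$ and $\theta(y)$ are both polynomials of degree one (constant terms allowed). For $f,g\in\mathbb{R}[x,y]$, write $f\sim g$ if there exist $\theta\in\Gamma_2(\mathbb{R})$ and $c\in\mathbb{R}^{\times}$ such that $\theta(f)=cg$. The list $\mathcal{L}=\mathcal{L}_1\cup\mathcal{L}_2\cup\mathcal{L}_3\cup\mathcal{L}_4$ consists of the following polynomials (each sign $\pm$ gives two families). $\mathcal{L}_1$ (canonical form $x^3+xy^2$): $x^3+xy^2+x^2+Hx+Iy+J$ with $H,J\in\mathbb{R}$, $I\ge 0$; $x^3+xy^2+y+Hx+J$ with $H\in\mathbb{R}$, $J\ge 0$; $x^3+xy^2\pm x+J$ with $J\ge 0$; $x^3+xy^2+1$; $x^3+xy^2$. $\mathcal{L}_2$ (canonical form $x^3-xy^2$): $x^3-xy^2-y^2+Hx+Iy+J$ with $J\in\mathbb{R}$, $I\ge 0$, $H+I\le -\frac{3}{4}$; $x^3-xy^2-y+Hx+J$ with $J\ge 0$, $H\in[-1,1]$; $x^3-xy^2+1$; $x^3-xy^2$. $\mathcal{L}_3$ (canonical form $x^2y$): $x^2y+y^2-x+Iy+J$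 with $I,J\in\mathbb{R}$; $x^2y+y^2\pm y+J$ with $J\in\mathbb{R}$; $x^2y+y^2\pm 1$; $x^2y+y^2$; $x^2y-x\pm y+J$ with $J\ge 0$; $x^2y\pm y+1$; $x^2y\pm y$; $x^2y-x+1$; $x^2y-x$; $x^2y-1$; $x^2y$. $\mathcal{L}_4$ (canonical form $x^3$): $x^3-y^2\pm x+J$ with $J\in\mathbb{R}$; $x^3-y^2\pm 1$; $x^3-y^2$; $x^3-y$; $x^3-xy+1$; $x^3-xy$; $x^3\pm x+J$ with $J\ge 0$; $x^3+1$; $x^3$. *)

theory Defs
  imports Complex_Main "HOL-Computational_Algebra.Polynomial"
begin

text \<open>The ring \<open>\<real>[x,y]\<close> is rendered as \<open>\<real>[x][y]\<close>: the inner variable is \<open>x\<close>, the outer one is \<open>y\<close>,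
  so \<open>coeff (coeff p j) i\<close> is the coefficient of \<open>x\<^sup>i y\<^sup>j\<close>.\<close>

type_synonym bipoly = "real poly poly"

definition PX :: bipoly where "PX = [:[:0, 1:]:]"

definition PY :: bipoly where "PY = [:0, 1:]"

definition PC :: "real \<Rightarrow> bipoly" where "PC c = [:[:c:]:]"

text \<open>Inserting 0 only serves to give the zero polynomial degree 0.\<close>

definition total_degree :: "bipoly \<Rightarrow> nat" where
  "total_degree p = Max (insert 0 {i + j | i j. coeff (coeff p j) i \<noteq> 0})"

definition ring_automorphism :: "('a::ring_1 \<Rightarrow> 'a) \<Rightarrow> bool" where
  "ring_automorphism \<theta> \<longleftrightarrow> bij \<theta> \<and> \<theta> 1 = 1 \<and>
     (\<forall>p q. \<theta> (p + q) = \<theta> p + \<theta> q) \<and> (\<forall>p q. \<theta> (p * q) = \<theta> p * \<theta> q)"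

text \<open>No \<open>\<real>\<close>-linearity is demanded of the automorphisms: units are mapped to units and \<open>\<real>\<close> has no
  nontrivial automorphism, so the constants are fixed anyway.\<close>

definition affine_group :: "(bipoly \<Rightarrow> bipoly) set" where
  "affine_group = {\<theta>. ring_automorphism \<theta> \<and> total_degree (\<theta> PX) = 1 \<and> total_degree (\<theta> PY) = 1}"

definition affine_equiv :: "bipoly \<Rightarrow> bipoly \<Rightarrow> bool" where
  "affine_equiv f g \<longleftrightarrow> (\<exists>\<theta>\<in>affine_group. \<exists>c::real. c \<noteq> 0 \<and> \<theta> f = PC c * g)"

text \<open>In the four lists below, \<open>s\<close> ranges over the two signs.\<close>

definition L1 :: "bipoly set" where
  "L1 =
     {PX^3 + PX * PY^2 + PX^2 + PC H * PX + PC I * PY + PC J | H I J. I \<ge> 0} \<union>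
     {PX^3 + PX * PY^2 + PY + PC H * PX + PC J | H J. J \<ge> 0} \<union>
     {PX^3 + PX * PY^2 + PC s * PX + PC J | s J. s \<in> {1, -1} \<and> J \<ge> 0} \<union>
     {PX^3 + PX * PY^2 + 1} \<union>
     {PX^3 + PX * PY^2}"

definition L2 :: "bipoly set" where
  "L2 =
     {PX^3 - PX * PY^2 - PY^2 + PC H * PX + PC I * PY + PC J | H I J. I \<ge> 0 \<and> H + I \<le> - 3 / 4} \<union>
     {PX^3 - PX * PY^2 - PY + PC H * PX + PC J | H J. J \<ge> 0 \<and> H \<in> {-1..1}} \<union>
     {PX^3 - PX * PY^2 + 1} \<union>
     {PX^3 - PX * PY^2}"

definition L3 :: "bipoly set" where
  "L3 =
     {PX^2 * PY + PY^2 - PX + PC I * PY + PC J | I J. True} \<union>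
     {PX^2 * PY + PY^2 + PC s * PY + PC J | s J. s \<in> {1, -1}} \<union>
     {PX^2 * PY + PY^2 + PC s | s. s \<in> {1, -1}} \<union>
     {PX^2 * PY + PY^2} \<union>
     {PX^2 * PY - PX + PC s * PY + PC J | s J. s \<in> {1, -1} \<and> J \<ge> 0} \<union>
     {PX^2 * PY + PC s * PY + 1 | s. s \<in> {1, -1}} \<union>
     {PX^2 * PY + PC s * PY | s. s \<in> {1, -1}} \<union>
     {PX^2 * PY - PX + 1} \<union>
     {PX^2 * PY - PX} \<union>
     {PX^2 * PY - 1} \<union>
     {PX^2 * PY}"

definition L4 :: "bipoly set" where
  "L4 =
     {PX^3 - PY^2 + PC s * PX + PC J | s J. s \<in> {1, -1}} \<union>
     {PX^3 - PY^2 + PC s | s. s \<in> {1, -1}} \<union>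
     {PX^3 - PY^2} \<union>
     {PX^3 - PY} \<union>
     {PX^3 - PX * PY + 1} \<union>
     {PX^3 - PX * PY} \<union>
     {PX^3 + PC s * PX + PC J | s J. s \<in> {1, -1} \<and> J \<ge> 0} \<union>
     {PX^3 + 1} \<union>
     {PX^3}"

definition cubic_list :: "bipoly set" where
  "cubic_list = L1 \<union> L2 \<union> L3 \<union> L4"

end

theory Submission imports Defs
begin

text \<open>
  A unit of \<open>\<real>[x,y]\<close> is a constant, and \<open>\<real>\<close> has no ring endomorphism but the identity, so an element
  of \<open>affine_group\<close> is precisely an invertible affine substitution, and \<open>f \<sim> g\<close> becomes an identity between
  polynomial functions, that is, ten polynomial equations in the entries of the substitution.

  The cubic part is a binary cubic form; it has a real linear factor, and completing the square in the
  remaining quadratic factor leads to \<open>x\<^sup>3 + xy\<^sup>2\<close>, \<open>x\<^sup>3 - xy\<^sup>2\<close>, \<open>x\<^sup>2y\<close> or \<open>x\<^sup>3\<close>. For each of these, translations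
  absorb part of the quadratic terms, and the stabilizer of the form up to scalars acts on what is left.
  This stabilizer consists of coordinate scalings (and shears for \<open>x\<^sup>3\<close>), except for \<open>x\<^sup>3 - xy\<^sup>2\<close>, where it also
  permutes the three real lines; the inequalities of \<open>L2\<close> describe a Weyl chamber of this \<open>S\<^sub>3\<close>-action.
\<close>

section \<open>Affine automorphisms as substitutions\<close>

text \<open>The number \<open>- 3 / 4\<close> in \<open>L2\<close> comes from a triangle:
  \<open>x^3 - x y^2 - y^2 - 3/4 x + 1/4\<close> factors as
  \<open>(x + 1) (x - 1/2 - y) (x - 1/2 + y)\<close>. The affine maps permuting its sides preserve
  the cubic and the quadratic part, so what they move is the difference
  \<open>h x + I y + const\<close> with \<open>h = H + 3/4\<close>. On \<open>(h, I)\<close> they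
  act as a reflection group with the mirrors \<open>I = 0\<close>, \<open>h = I\<close> and
  \<open>h = - I\<close>. Without a quadratic term the mirrors are the same lines through
  \<open>H = I = 0\<close>. The rest is a matter of weights: a scaling multiplies each surviving
  coefficient by a monomial in its entries. A coefficient of odd weight can be made \<open>1\<close>
  (or \<open>-1\<close>). One of even weight keeps its sign unless a reflection changes it, which
  accounts for the signs in the list. Where this leaves both \<open>a = 1\<close> and
  \<open>a = -1\<close> and the constant term has odd weight, its sign can still be flipped, which
  accounts for \<open>J \<ge> 0\<close>.\<close>

definition eval2 :: "bipoly \<Rightarrow> real \<Rightarrow> real \<Rightarrow> real" where
  "eval2 p x y = poly (poly p [:y:]) x"

lemma eval2_simps [simp]:
  "eval2 PX x y = x" "eval2 PY x y = y" "eval2 (PC c) x y = c"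
  "eval2 0 x y = 0" "eval2 1 x y = 1"
  "eval2 (p + q) x y = eval2 p x y + eval2 q x y"
  "eval2 (p - q) x y = eval2 p x y - eval2 q x y"
  "eval2 (- p) x y = - eval2 p x y"
  "eval2 (p * q) x y = eval2 p x y * eval2 q x y"
  "eval2 (p ^ n) x y = eval2 p x y ^ n"
  by (simp_all add: eval2_def PX_def PY_def PC_def)

lemma PC_hom: "PC 0 = 0" "PC 1 = 1" "PC (a + b) = PC a + PC b" "PC (a * b) = PC a * PC b"
    "PC (- a) = - PC a"
  by (simp_all add: PC_def one_pCons)

lemma PC_inject: "PC a = PC b \<longleftrightarrow> a = b"
  by (simp add: PC_def)

text \<open>For fixed \<open>y\<close> the difference becomes a polynomial in \<open>x\<close> that
  vanishes everywhere. So \<open>p - q\<close>, as a polynomial over the domain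
  \<open>real poly\<close>, has the infinitely many roots \<open>[:y:]\<close> and is zero.\<close>

lemma eval2_inject: "eval2 p = eval2 q \<longleftrightarrow> p = q"
proof
  assume eq: "eval2 p = eval2 q"
  have "poly (p - q) [:y:] = 0" for y
  proof -
    have "poly (poly (p - q) [:y:]) x = 0" for x
      using fun_cong[OF fun_cong[OF eq, of x], of y] by (simp add: eval2_def)
    then show ?thesis
      using poly_all_0_iff_0 by blast
  qed
  then have "range (\<lambda>y::real. [:y:]) \<subseteq> {c. poly (p - q) c = 0}"
    by auto
  moreover have "infinite (range (\<lambda>y::real. [:y:]))"
    using finite_imageD[of "\<lambda>y::real. [:y:]" UNIV] by (auto simp: inj_on_def infinite_UNIV_char_0)
  ultimately show "p = q"
    using poly_roots_finite[of "p - q"] finite_subset by auto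
qed simp

text \<open>Horner form in each variable: the constants and the two variables generate the
  ring.\<close>

lemma bipoly_induct [case_names const X Y add mult]:
  assumes "\<And>c. P (PC c)" "P PX" "P PY"
    and "\<And>p q. P p \<Longrightarrow> P q \<Longrightarrow> P (p + q)" "\<And>p q. P p \<Longrightarrow> P q \<Longrightarrow> P (p * q)"
  shows "P p"
proof (induction p rule: pCons_induct)
  case 0
  show ?case using assms(1)[of 0] by (simp add: PC_def)
next
  case (pCons c q)
  have "P [:c:]"
  proof (induction c rule: pCons_induct)
    case 0
    show ?case using assms(1)[of 0] by (simp add: PC_def)
  next
    case (pCons r c)
    have "[:pCons r c:] = PC r + PX * [:c:]"
      by (simp add: PC_def PX_def)
    with pCons assms show ?case by presburger
  qed
  moreover have "pCons c q = [:c:] + PY * q"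
    by (simp add: PY_def)
  ultimately show ?case using pCons assms by presburger
qed

text \<open>\<open>Max\<close> is only meaningful on finite sets; this makes
  \<open>total_degree\<close> computable.\<close>

lemma finite_total_degrees: "finite {i + j | i j. coeff (coeff (p :: bipoly) j) i \<noteq> 0}"
proof -
  have "{i + j | i j. coeff (coeff p j) i \<noteq> 0} \<subseteq>
      (\<Union>j\<in>{..degree p}. (\<lambda>i. i + j) ` {..degree (coeff p j)})"
  proof safe
    fix i j
    assume "coeff (coeff p j) i \<noteq> 0"
    then have "j \<le> degree p" "i \<le> degree (coeff p j)"
      by (auto intro!: le_degree)
    then show "i + j \<in> (\<Union>j\<in>{..degree p}. (\<lambda>i. i + j) ` {..degree (coeff p j)})"
      by blast
  qed
  then show ?thesis
    by (rule finite_subset) auto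
qed

lemma total_degree_eq_iff:
  assumes "n > 0"
  shows "total_degree p = n \<longleftrightarrow>
    (\<forall>i j. coeff (coeff p j) i \<noteq> 0 \<longrightarrow> i + j \<le> n) \<and> (\<exists>i j. i + j = n \<and> coeff (coeff p j) i \<noteq> 0)"
  unfolding total_degree_def using assms finite_total_degrees[of p]
  by (subst Max_eq_iff) auto

text \<open>Additivity and \<open>g 1 = 1\<close> fix the rationals. Nonnegative reals are squares,
  so their images are nonnegative and \<open>g\<close> is monotone; a rational strictly between
  \<open>x\<close> and \<open>g x\<close> would contradict this.\<close>

lemma real_field_hom_id:
  fixes g :: "real \<Rightarrow> real"
  assumes one: "g 1 = 1" and add: "\<And>x y. g (x + y) = g x + g y"
    and mult: "\<And>x y. g (x * y) = g x * g y"
  shows "g x = x"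
proof -
  have zero: "g 0 = 0" using add[of 0 0] by simp
  have minus: "g (- x) = - g x" for x using add[of x "- x"] zero by simp
  have nat: "g (of_nat n) = of_nat n" for n
    by (induction n) (simp_all add: zero one add)
  have int: "g (of_int n) = of_int n" for n
    by (cases n rule: int_diff_cases) (simp add: diff_conv_add_uminus add minus nat del: add_uminus_conv_diff)
  have rat: "g (of_rat q) = of_rat q" for q
  proof (cases q)
    case (Fract a b)
    have "of_int b * g (of_rat q) = g (of_int b * of_rat q)" by (simp add: mult int)
    also have "of_int b * of_rat q = (of_int a :: real)"
      using Fract by (simp add: of_rat_rat)
    finally show ?thesis using Fract by (simp add: of_rat_rat int field_simps)
  qed
  have mono: "g x \<le> g y" if "x \<le> y" for x y
  proof -
    have "g (y - x) = g (sqrt (y - x)) * g (sqrt (y - x))"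
      using that by (simp flip: mult)
    then have "g (y - x) \<ge> 0" by simp
    then show ?thesis using add[of "y - x" x] by simp
  qed
  show ?thesis
  proof (rule ccontr)
    assume "g x \<noteq> x"
    then consider "g x < x" | "x < g x" by linarith
    then show False
    proof cases
      case 1
      obtain q where "g x < of_rat q" "of_rat q < x" using of_rat_dense[OF 1] by blast
      then show False using mono[of "of_rat q" x] rat[of q] by simp
    next
      case 2
      obtain q where "x < of_rat q" "of_rat q < g x" using of_rat_dense[OF 2] by blast
      then show False using mono[of x "of_rat q"] rat[of q] by simp
    qed
  qed
qed

lemma ring_automorphism_PC:
  assumes "ring_automorphism \<theta>"
  shows "\<theta> (PC r) = PC r"
proof -
  have \<theta>: "\<theta> 1 = 1" "\<And>p q. \<theta> (p + q) = \<theta> p + \<theta> q" "\<And>p q. \<theta> (p * q) = \<theta> p * \<theta> q"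
    using assms by (auto simp: ring_automorphism_def)
  have \<theta>0: "\<theta> 0 = 0" using \<theta>(2)[of 0 0] by simp
  have "\<exists>s. \<theta> (PC r) = PC s" for r
  proof (cases "r = 0")
    case True
    then show ?thesis using \<theta>0 by (auto simp: PC_def)
  next
    case False
    then have "PC r * PC (1 / r) = 1" by (simp add: PC_def one_pCons)
    then have "\<theta> (PC r) dvd 1" by (metis \<theta>(1,3) dvd_triv_left)
    then show ?thesis by (auto simp: is_unit_poly_iff PC_def)
  qed
  then obtain g where g: "\<And>r. \<theta> (PC r) = PC (g r)" by metis
  have "g r = r"
  proof (rule real_field_hom_id)
    show "g 1 = 1" using g[of 1] \<theta>(1) by (simp add: PC_hom flip: PC_inject)
    show "g (x + y) = g x + g y" for x y by (simp add: PC_hom \<theta>(2) flip: PC_inject g)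
    show "g (x * y) = g x * g y" for x y by (simp add: PC_hom \<theta>(3) flip: PC_inject g)
  qed
  then show ?thesis using g by simp
qed

lemma total_degree_one_affine:
  assumes "total_degree p = 1"
  obtains a b u where "p = PC a * PX + PC b * PY + PC u"
proof
  have *: "coeff (coeff p j) i = 0" if "i + j > 1" for i j
    using assms that by (metis total_degree_eq_iff zero_less_one not_le)
  show "p = PC (coeff (coeff p 0) 1) * PX + PC (coeff (coeff p 1) 0) * PY + PC (coeff (coeff p 0) 0)"
    by (intro poly_eqI) (auto simp: PC_def PX_def PY_def coeff_pCons * split: nat.split)
qed

lemma total_degree_linear:
  assumes "a \<noteq> 0 \<or> b \<noteq> 0"
  shows "total_degree (PC a * PX + PC b * PY + PC u) = 1"
proof -
  have "coeff (coeff (PC a * PX + PC b * PY + PC u) j) i =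
      (if i = 0 \<and> j = 0 then u else if i = 1 \<and> j = 0 then a else if i = 0 \<and> j = 1 then b else 0)" for i j
    by (auto simp: PC_def PX_def PY_def coeff_pCons split: nat.split)
  then show ?thesis
    using assms by (subst total_degree_eq_iff) (auto split: if_splits)
qed

text \<open>Stated for arbitrary functions, so that symmetry and transitivity are inversion and
  composition of affine maps of the plane.\<close>

definition subst_equiv :: "(real \<Rightarrow> real \<Rightarrow> real) \<Rightarrow> (real \<Rightarrow> real \<Rightarrow> real) \<Rightarrow> bool" where
  "subst_equiv F G \<longleftrightarrow> (\<exists>a b u c d v k. a * d - b * c \<noteq> 0 \<and> k \<noteq> 0 \<and>
     (\<forall>x y. F (a * x + b * y + u) (c * x + d * y + v) = k * G x y))"

lemma eval2_ring_automorphism: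
  assumes "ring_automorphism \<theta>"
  shows "eval2 (\<theta> p) x y = eval2 p (eval2 (\<theta> PX) x y) (eval2 (\<theta> PY) x y)"
  using assms
  by (induction p rule: bipoly_induct) (simp_all add: ring_automorphism_PC, simp_all add: ring_automorphism_def)

lemma affine_equiv_imp_subst_equiv:
  assumes "affine_equiv f g"
  shows "subst_equiv (eval2 f) (eval2 g)"
proof -
  from assms obtain \<theta> k where aut: "ring_automorphism \<theta>" and k: "k \<noteq> 0" "\<theta> f = PC k * g"
    and deg: "total_degree (\<theta> PX) = 1" "total_degree (\<theta> PY) = 1"
    by (auto simp: affine_equiv_def affine_group_def)
  obtain a b u where X: "\<theta> PX = PC a * PX + PC b * PY + PC u"
    using deg(1) by (rule total_degree_one_affine)
  obtain c d v where Y: "\<theta> PY = PC c * PX + PC d * PY + PC v"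
    using deg(2) by (rule total_degree_one_affine)
  have "a * d - b * c \<noteq> 0"
  proof
    assume det: "a * d - b * c = 0"
    \<comment> \<open>A linear relation between the rows of the matrix makes
      \<open>s * \<theta> PX + t * \<theta> PY\<close> constant. Then \<open>\<theta>\<close> kills
      \<open>q\<close>, and injectivity forces \<open>s = t = 0\<close>.\<close>
    have dependent: "s = 0 \<and> t = 0" if "s * a + t * c = 0" "s * b + t * d = 0" for s t
    proof -
      define q where "q = PC s * PX + PC t * PY - PC (s * u + t * v)"
      have "eval2 (\<theta> q) x y = 0" for x y
      proof -
        have "eval2 (\<theta> q) x y = (s * a + t * c) * x + (s * b + t * d) * y"
          by (simp add: eval2_ring_automorphism[OF aut] X Y q_def algebra_simps)
        then show ?thesis using that by simp
      qed
      then have "\<theta> q = 0"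
        by (simp add: fun_eq_iff flip: eval2_inject)
      also have "0 = \<theta> 0"
        using ring_automorphism_PC[OF aut, of 0] by (simp add: PC_hom)
      finally have "q = 0"
        using aut by (simp add: ring_automorphism_def bij_def inj_eq)
      then have "eval2 q x y = 0" for x y by simp
      from this[of 0 0] this[of 1 0] this[of 0 1] show ?thesis by (simp add: q_def)
    qed
    \<comment> \<open>For a vanishing determinant the rows of the adjugate matrix are such
      relations, so all entries are zero; but then \<open>1, 0\<close> is a relation too.\<close>
    from dependent[of d "- b"] dependent[of "-c" a] det have "a = 0 \<and> b = 0 \<and> c = 0 \<and> d = 0"
      by (simp add: algebra_simps)
    then show False using dependent[of 1 0] by simp
  qed
  moreover have "eval2 f (a * x + b * y + u) (c * x + d * y + v) = k * eval2 g x y" for x y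
    using eval2_ring_automorphism[OF aut, of f x y] by (simp add: k X Y)
  ultimately show ?thesis
    unfolding subst_equiv_def using k by blast
qed

lemma affine_map_inverse:
  fixes a b c d u v :: real
  assumes "a * d - b * c \<noteq> 0"
  obtains \<alpha> \<beta> \<mu> \<gamma> \<delta> \<nu> where "\<alpha> * \<delta> - \<beta> * \<gamma> \<noteq> 0"
    and "\<And>x y. \<alpha> * (a * x + b * y + u) + \<beta> * (c * x + d * y + v) + \<mu> = x"
    and "\<And>x y. \<gamma> * (a * x + b * y + u) + \<delta> * (c * x + d * y + v) + \<nu> = y"
    and "\<And>x y. a * (\<alpha> * x + \<beta> * y + \<mu>) + b * (\<gamma> * x + \<delta> * y + \<nu>) + u = x"
    and "\<And>x y. c * (\<alpha> * x + \<beta> * y + \<mu>) + d * (\<gamma> * x + \<delta> * y + \<nu>) + v = y"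
proof -
  define D where "D = a * d - b * c"
  have D: "D \<noteq> 0" using assms by (simp add: D_def)
  show thesis
  proof (rule that[of "d / D" "a / D" "- b / D" "- c / D" "(b * v - d * u) / D" "(c * u - a * v) / D"])
    have "d / D * (a / D) - - b / D * (- c / D) = (a * d - b * c) / (D * D)"
      using D by (simp add: field_simps)
    then show "d / D * (a / D) - - b / D * (- c / D) \<noteq> 0" using D assms by simp
  qed (use D in \<open>simp_all add: field_simps\<close>, simp_all add: D_def algebra_simps)
qed

text \<open>The image is found for one polynomial at a time and the map assembled by choice. The
  homomorphism laws follow from the pointwise description by \<open>eval2_inject\<close>.\<close>

lemma affine_substitution_exists:
  "\<exists>\<theta>. \<forall>p x y. eval2 (\<theta> p) x y = eval2 p (a * x + b * y + u) (c * x + d * y + v)"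
proof (rule choice, rule allI)
  fix p
  show "\<exists>q. \<forall>x y. eval2 q x y = eval2 p (a * x + b * y + u) (c * x + d * y + v)"
  proof (induction p rule: bipoly_induct)
    case (const r)
    show ?case by (rule exI[of _ "PC r"]) simp
  next
    case X
    show ?case by (rule exI[of _ "PC a * PX + PC b * PY + PC u"]) simp
  next
    case Y
    show ?case by (rule exI[of _ "PC c * PX + PC d * PY + PC v"]) simp
  next
    case (add p q)
    then show ?case by (metis eval2_simps(6))
  next
    case (mult p q)
    then show ?case by (metis eval2_simps(9))
  qed
qed

lemma subst_equiv_imp_affine_equiv:
  assumes "subst_equiv (eval2 f) (eval2 g)"
  shows "affine_equiv f g"
proof -
  from assms obtain a b u c d v k where det: "a * d - b * c \<noteq> 0" and k: "k \<noteq> 0"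
    and fg: "\<And>x y. eval2 f (a * x + b * y + u) (c * x + d * y + v) = k * eval2 g x y"
    unfolding subst_equiv_def by blast
  obtain \<theta> where \<theta>: "\<And>p x y. eval2 (\<theta> p) x y = eval2 p (a * x + b * y + u) (c * x + d * y + v)"
    using affine_substitution_exists by metis
  obtain \<alpha> \<beta> \<mu> \<gamma> \<delta> \<nu> where 1:
    "\<And>x y. \<alpha> * (a * x + b * y + u) + \<beta> * (c * x + d * y + v) + \<mu> = x"
    "\<And>x y. \<gamma> * (a * x + b * y + u) + \<delta> * (c * x + d * y + v) + \<nu> = y"
    "\<And>x y. a * (\<alpha> * x + \<beta> * y + \<mu>) + b * (\<gamma> * x + \<delta> * y + \<nu>) + u = x"
    "\<And>x y. c * (\<alpha> * x + \<beta> * y + \<mu>) + d * (\<gamma> * x + \<delta> * y + \<nu>) + v = y"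
    using affine_map_inverse[OF det, of u v] by metis
  obtain \<eta> where \<eta>: "\<And>p x y. eval2 (\<eta> p) x y = eval2 p (\<alpha> * x + \<beta> * y + \<mu>) (\<gamma> * x + \<delta> * y + \<nu>)"
    using affine_substitution_exists by metis
  have "\<theta> (\<eta> p) = p" "\<eta> (\<theta> p) = p" for p
    by (simp_all add: fun_eq_iff \<theta> \<eta> 1 flip: eval2_inject)
  then have "bij \<theta>" by (metis bijI')
  then have "ring_automorphism \<theta>"
    unfolding ring_automorphism_def by (simp add: fun_eq_iff \<theta> flip: eval2_inject)
  moreover have "\<theta> PX = PC a * PX + PC b * PY + PC u" "\<theta> PY = PC c * PX + PC d * PY + PC v"
    by (simp_all add: fun_eq_iff \<theta> flip: eval2_inject)
  moreover have "a \<noteq> 0 \<or> b \<noteq> 0" "c \<noteq> 0 \<or> d \<noteq> 0" using det by auto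
  ultimately have "\<theta> \<in> affine_group"
    by (simp add: affine_group_def total_degree_linear)
  moreover have "\<theta> f = PC k * g"
    by (simp add: fun_eq_iff \<theta> fg flip: eval2_inject)
  ultimately show ?thesis using k by (auto simp: affine_equiv_def)
qed

lemma affine_equiv_iff: "affine_equiv f g \<longleftrightarrow> subst_equiv (eval2 f) (eval2 g)"
  using affine_equiv_imp_subst_equiv subst_equiv_imp_affine_equiv by blast

section \<open>Substitution into a general cubic\<close>

definition cubic :: "real \<Rightarrow> real \<Rightarrow> real \<Rightarrow> real \<Rightarrow> real \<Rightarrow> real \<Rightarrow> real \<Rightarrow> real \<Rightarrow> real \<Rightarrow> real
    \<Rightarrow> real \<Rightarrow> real \<Rightarrow> real" where
  "cubic p q r s \<alpha> \<beta> \<gamma> H I J x y =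
     p * x^3 + q * x^2 * y + r * x * y^2 + s * y^3 + \<alpha> * x^2 + \<beta> * x * y + \<gamma> * y^2 + H * x + I * y + J"

lemma total_degree_three_cubic:
  assumes "total_degree f = 3"
  obtains p q r s \<alpha> \<beta> \<gamma> H I J where
    "eval2 f = cubic p q r s \<alpha> \<beta> \<gamma> H I J" "p \<noteq> 0 \<or> q \<noteq> 0 \<or> r \<noteq> 0 \<or> s \<noteq> 0"
proof
  let ?c = "\<lambda>i j. coeff (coeff f j) i"
  have *: "?c i j = 0" if "i + j > 3" for i j
    using assms that by (metis total_degree_eq_iff zero_less_numeral not_le)
  have "f = [: [: ?c 0 0, ?c 1 0, ?c 2 0, ?c 3 0 :], [: ?c 0 1, ?c 1 1, ?c 2 1 :],
               [: ?c 0 2, ?c 1 2 :], [: ?c 0 3 :] :]" (is "f = ?f")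
    by (intro poly_eqI)
       (auto simp: coeff_pCons * numeral_2_eq_2 numeral_3_eq_3 split: nat.split)
  then have "eval2 f x y = eval2 ?f x y" for x y
    by (rule arg_cong)
  then show "eval2 f = cubic (?c 3 0) (?c 2 1) (?c 1 2) (?c 0 3) (?c 2 0) (?c 1 1) (?c 0 2) (?c 1 0) (?c 0 1) (?c 0 0)"
    by (simp add: fun_eq_iff) (simp add: eval2_def cubic_def algebra_simps power2_eq_square power3_eq_cube)
  obtain i j where "i + j = 3" "?c i j \<noteq> 0"
    using assms total_degree_eq_iff[of 3 f] by auto
  moreover have "i = 3 \<and> j = 0 \<or> i = 2 \<and> j = 1 \<or> i = 1 \<and> j = 2 \<or> i = 0 \<and> j = 3"
    using \<open>i + j = 3\<close> by presburger
  ultimately show "?c 3 0 \<noteq> 0 \<or> ?c 2 1 \<noteq> 0 \<or> ?c 1 2 \<noteq> 0 \<or> ?c 0 3 \<noteq> 0" by auto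
qed

section \<open>Equivalence relation on functions of the plane\<close>

lemma subst_equiv_refl: "subst_equiv F F"
  unfolding subst_equiv_def
  by (rule exI[of _ 1], rule exI[of _ 0], rule exI[of _ 0], rule exI[of _ 0], rule exI[of _ 1],
      rule exI[of _ 0], rule exI[of _ 1]) simp

lemma subst_equiv_sym:
  assumes "subst_equiv F G"
  shows "subst_equiv G F"
proof -
  from assms obtain a b u c d v k where det: "a * d - b * c \<noteq> 0" and k: "k \<noteq> 0"
    and FG: "\<And>x y. F (a * x + b * y + u) (c * x + d * y + v) = k * G x y"
    unfolding subst_equiv_def by blast
  obtain \<alpha> \<beta> \<mu> \<gamma> \<delta> \<nu> where det': "\<alpha> * \<delta> - \<beta> * \<gamma> \<noteq> 0" and 1:
    "\<And>x y. a * (\<alpha> * x + \<beta> * y + \<mu>) + b * (\<gamma> * x + \<delta> * y + \<nu>) + u = x"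
    "\<And>x y. c * (\<alpha> * x + \<beta> * y + \<mu>) + d * (\<gamma> * x + \<delta> * y + \<nu>) + v = y"
    using affine_map_inverse[OF det, of u v] by metis
  have "G (\<alpha> * x + \<beta> * y + \<mu>) (\<gamma> * x + \<delta> * y + \<nu>) = 1 / k * F x y" for x y
    using FG[of "\<alpha> * x + \<beta> * y + \<mu>" "\<gamma> * x + \<delta> * y + \<nu>"] k by (simp add: 1)
  then show ?thesis
    unfolding subst_equiv_def using k det' by (metis divide_eq_0_iff one_neq_zero)
qed

lemma subst_equiv_trans [trans]:
  assumes "subst_equiv F G" "subst_equiv G K"
  shows "subst_equiv F K"
proof -
  from assms(1) obtain a b u c d v k where 1: "a * d - b * c \<noteq> 0" "k \<noteq> 0"
    and FG: "\<And>x y. F (a * x + b * y + u) (c * x + d * y + v) = k * G x y"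
    unfolding subst_equiv_def by blast
  from assms(2) obtain a' b' u' c' d' v' k' where 2: "a' * d' - b' * c' \<noteq> 0" "k' \<noteq> 0"
    and GK: "\<And>x y. G (a' * x + b' * y + u') (c' * x + d' * y + v') = k' * K x y"
    unfolding subst_equiv_def by blast
  show ?thesis
    unfolding subst_equiv_def
  proof (intro exI conjI allI)
    have "(a * a' + b * c') * (c * b' + d * d') - (a * b' + b * d') * (c * a' + d * c') =
        (a * d - b * c) * (a' * d' - b' * c')"
      by (simp add: algebra_simps)
    then show "(a * a' + b * c') * (c * b' + d * d') - (a * b' + b * d') * (c * a' + d * c') \<noteq> 0"
      using 1 2 by simp
    show "k * k' \<noteq> 0" using 1 2 by simp
    fix x y
    show "F ((a * a' + b * c') * x + (a * b' + b * d') * y + (a * u' + b * v' + u))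
            ((c * a' + d * c') * x + (c * b' + d * d') * y + (c * u' + d * v' + v)) = k * k' * K x y"
      using FG[of "a' * x + b' * y + u'" "c' * x + d' * y + v'", unfolded GK]
      by (simp add: algebra_simps)
  qed
qed

text \<open>Ten values determine the ten coefficients: at the origin, at three further points of
  each axis, and at \<open>(1, 1)\<close>, \<open>(1, -1)\<close>, \<open>(-1, 1)\<close>.\<close>

lemma cubic_inject:
  assumes "\<And>x y. cubic p q r s \<alpha> \<beta> \<gamma> H I J x y = cubic p' q' r' s' \<alpha>' \<beta>' \<gamma>' H' I' J' x y"
  shows "p = p' \<and> q = q' \<and> r = r' \<and> s = s' \<and> \<alpha> = \<alpha>' \<and> \<beta> = \<beta>' \<and> \<gamma> = \<gamma>' \<and> H = H' \<and> I = I' \<and> J = J'"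
proof -
  note e = assms[unfolded cubic_def]
  have J: "J = J'" using e[of 0 0] by simp
  have x: "p = p'" "\<alpha> = \<alpha>'" "H = H'"
    using e[of 1 0] e[of "-1" 0] e[of 2 0] J by simp_all
  have y: "s = s'" "\<gamma> = \<gamma>'" "I = I'"
    using e[of 0 1] e[of 0 "-1"] e[of 0 2] J by simp_all
  have "q = q'" "r = r'" "\<beta> = \<beta>'"
    using e[of 1 1] e[of 1 "-1"] e[of "-1" 1] J x y by simp_all
  with J x y show ?thesis by simp
qed

text \<open>The system is triangular: the first four coefficients depend only on the cubic part and
  the matrix, and the next three contain the translation linearly. Hence cubic part, quadratic part
  and rest can be treated one after the other.\<close>

lemma cubic_affine:
  "cubic p q r s \<alpha> \<beta> \<gamma> H I J (a * x + b * y + u) (c * x + d * y + v) =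
   cubic
    (p * a^3 + q * a^2 * c + r * a * c^2 + s * c^3)
    (3 * p * a^2 * b + q * (a^2 * d + 2 * a * b * c) + r * (b * c^2 + 2 * a * c * d) + 3 * s * c^2 * d)
    (3 * p * a * b^2 + q * (b^2 * c + 2 * a * b * d) + r * (a * d^2 + 2 * b * c * d) + 3 * s * c * d^2)
    (p * b^3 + q * b^2 * d + r * b * d^2 + s * d^3)
    (3 * p * a^2 * u + q * (a^2 * v + 2 * a * u * c) + r * (u * c^2 + 2 * a * c * v) + 3 * s * c^2 * v
      + \<alpha> * a^2 + \<beta> * a * c + \<gamma> * c^2)
    (6 * p * a * b * u + q * (2 * a * b * v + 2 * a * u * d + 2 * b * u * c)
      + r * (2 * u * c * d + 2 * a * d * v + 2 * b * c * v) + 6 * s * c * d * v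
      + 2 * \<alpha> * a * b + \<beta> * (a * d + b * c) + 2 * \<gamma> * c * d)
    (3 * p * b^2 * u + q * (b^2 * v + 2 * b * u * d) + r * (u * d^2 + 2 * b * d * v) + 3 * s * d^2 * v
      + \<alpha> * b^2 + \<beta> * b * d + \<gamma> * d^2)
    (3 * p * a * u^2 + q * (2 * a * u * v + u^2 * c) + r * (a * v^2 + 2 * u * c * v) + 3 * s * c * v^2
      + 2 * \<alpha> * a * u + \<beta> * (a * v + u * c) + 2 * \<gamma> * c * v + H * a + I * c)
    (3 * p * b * u^2 + q * (2 * b * u * v + u^2 * d) + r * (b * v^2 + 2 * u * d * v) + 3 * s * d * v^2
      + 2 * \<alpha> * b * u + \<beta> * (b * v + u * d) + 2 * \<gamma> * d * v + H * b + I * d)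
    (p * u^3 + q * u^2 * v + r * u * v^2 + s * v^3 + \<alpha> * u^2 + \<beta> * u * v + \<gamma> * v^2 + H * u + I * v + J)
    x y"
  by (simp add: cubic_def power2_eq_square power3_eq_cube distrib_left distrib_right mult_ac add_ac)

lemma cubic_scale:
  "k * cubic p q r s \<alpha> \<beta> \<gamma> H I J x y =
   cubic (k * p) (k * q) (k * r) (k * s) (k * \<alpha>) (k * \<beta>) (k * \<gamma>) (k * H) (k * I) (k * J) x y"
  by (simp add: cubic_def algebra_simps)

section \<open>Equivalence of cubics as ten coefficient equations\<close>

lemma subst_equiv_cubicI:
  assumes "a * d - b * c \<noteq> 0" "k \<noteq> 0"
    and "p * a^3 + q * a^2 * c + r * a * c^2 + s * c^3 = k * p'"
    and "3 * p * a^2 * b + q * (a^2 * d + 2 * a * b * c) + r * (b * c^2 + 2 * a * c * d)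
      + 3 * s * c^2 * d = k * q'"
    and "3 * p * a * b^2 + q * (b^2 * c + 2 * a * b * d) + r * (a * d^2 + 2 * b * c * d)
      + 3 * s * c * d^2 = k * r'"
    and "p * b^3 + q * b^2 * d + r * b * d^2 + s * d^3 = k * s'"
    and "3 * p * a^2 * u + q * (a^2 * v + 2 * a * u * c) + r * (u * c^2 + 2 * a * c * v) + 3 * s * c^2 * v
      + \<alpha> * a^2 + \<beta> * a * c + \<gamma> * c^2 = k * \<alpha>'"
    and "6 * p * a * b * u + q * (2 * a * b * v + 2 * a * u * d + 2 * b * u * c)
      + r * (2 * u * c * d + 2 * a * d * v + 2 * b * c * v) + 6 * s * c * d * v
      + 2 * \<alpha> * a * b + \<beta> * (a * d + b * c) + 2 * \<gamma> * c * d = k * \<beta>'"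
    and "3 * p * b^2 * u + q * (b^2 * v + 2 * b * u * d) + r * (u * d^2 + 2 * b * d * v) + 3 * s * d^2 * v
      + \<alpha> * b^2 + \<beta> * b * d + \<gamma> * d^2 = k * \<gamma>'"
    and "3 * p * a * u^2 + q * (2 * a * u * v + u^2 * c) + r * (a * v^2 + 2 * u * c * v) + 3 * s * c * v^2
      + 2 * \<alpha> * a * u + \<beta> * (a * v + u * c) + 2 * \<gamma> * c * v + H * a + I * c = k * H'"
    and "3 * p * b * u^2 + q * (2 * b * u * v + u^2 * d) + r * (b * v^2 + 2 * u * d * v) + 3 * s * d * v^2
      + 2 * \<alpha> * b * u + \<beta> * (b * v + u * d) + 2 * \<gamma> * d * v + H * b + I * d = k * I'"
    and "p * u^3 + q * u^2 * v + r * u * v^2 + s * v^3 + \<alpha> * u^2 + \<beta> * u * v + \<gamma> * v^2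
      + H * u + I * v + J = k * J'"
  shows "subst_equiv (cubic p q r s \<alpha> \<beta> \<gamma> H I J) (cubic p' q' r' s' \<alpha>' \<beta>' \<gamma>' H' I' J')"
proof -
  have "cubic p q r s \<alpha> \<beta> \<gamma> H I J (a * x + b * y + u) (c * x + d * y + v) =
      k * cubic p' q' r' s' \<alpha>' \<beta>' \<gamma>' H' I' J' x y" for x y
    by (simp only: cubic_affine cubic_scale assms(3-))
  with assms(1,2) show ?thesis
    unfolding subst_equiv_def by blast
qed

lemma subst_equiv_cubicE:
  assumes "subst_equiv (cubic p q r s \<alpha> \<beta> \<gamma> H I J) (cubic p' q' r' s' \<alpha>' \<beta>' \<gamma>' H' I' J')"
  obtains a b u c d v k where "a * d - b * c \<noteq> 0" "k \<noteq> 0"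
    and "p * a^3 + q * a^2 * c + r * a * c^2 + s * c^3 = k * p'"
    and "3 * p * a^2 * b + q * (a^2 * d + 2 * a * b * c) + r * (b * c^2 + 2 * a * c * d)
      + 3 * s * c^2 * d = k * q'"
    and "3 * p * a * b^2 + q * (b^2 * c + 2 * a * b * d) + r * (a * d^2 + 2 * b * c * d)
      + 3 * s * c * d^2 = k * r'"
    and "p * b^3 + q * b^2 * d + r * b * d^2 + s * d^3 = k * s'"
    and "3 * p * a^2 * u + q * (a^2 * v + 2 * a * u * c) + r * (u * c^2 + 2 * a * c * v) + 3 * s * c^2 * v
      + \<alpha> * a^2 + \<beta> * a * c + \<gamma> * c^2 = k * \<alpha>'"
    and "6 * p * a * b * u + q * (2 * a * b * v + 2 * a * u * d + 2 * b * u * c)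
      + r * (2 * u * c * d + 2 * a * d * v + 2 * b * c * v) + 6 * s * c * d * v
      + 2 * \<alpha> * a * b + \<beta> * (a * d + b * c) + 2 * \<gamma> * c * d = k * \<beta>'"
    and "3 * p * b^2 * u + q * (b^2 * v + 2 * b * u * d) + r * (u * d^2 + 2 * b * d * v) + 3 * s * d^2 * v
      + \<alpha> * b^2 + \<beta> * b * d + \<gamma> * d^2 = k * \<gamma>'"
    and "3 * p * a * u^2 + q * (2 * a * u * v + u^2 * c) + r * (a * v^2 + 2 * u * c * v) + 3 * s * c * v^2
      + 2 * \<alpha> * a * u + \<beta> * (a * v + u * c) + 2 * \<gamma> * c * v + H * a + I * c = k * H'"
    and "3 * p * b * u^2 + q * (2 * b * u * v + u^2 * d) + r * (b * v^2 + 2 * u * d * v) + 3 * s * d * v^2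
      + 2 * \<alpha> * b * u + \<beta> * (b * v + u * d) + 2 * \<gamma> * d * v + H * b + I * d = k * I'"
    and "p * u^3 + q * u^2 * v + r * u * v^2 + s * v^3 + \<alpha> * u^2 + \<beta> * u * v + \<gamma> * v^2
      + H * u + I * v + J = k * J'"
proof -
  from assms obtain a b u c d v k where 1: "a * d - b * c \<noteq> 0" "k \<noteq> 0"
    and 2: "\<And>x y. cubic p q r s \<alpha> \<beta> \<gamma> H I J (a * x + b * y + u) (c * x + d * y + v) =
      k * cubic p' q' r' s' \<alpha>' \<beta>' \<gamma>' H' I' J' x y"
    unfolding subst_equiv_def by blast
  note 3 = cubic_inject[OF 2[unfolded cubic_affine cubic_scale]]
  show thesis
    by (rule that[where u = u and v = v, OF 1]) (simp_all only: 3)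
qed

text \<open>Unification supplies the last three coefficients, so quadratic terms can be cleared
  without computing what becomes of the lower ones.\<close>

lemma subst_equiv_cubic_quadratic:
  assumes "a * d - b * c \<noteq> 0"
    and "p * a^3 + q * a^2 * c + r * a * c^2 + s * c^3 = p'"
    and "3 * p * a^2 * b + q * (a^2 * d + 2 * a * b * c) + r * (b * c^2 + 2 * a * c * d)
      + 3 * s * c^2 * d = q'"
    and "3 * p * a * b^2 + q * (b^2 * c + 2 * a * b * d) + r * (a * d^2 + 2 * b * c * d)
      + 3 * s * c * d^2 = r'"
    and "p * b^3 + q * b^2 * d + r * b * d^2 + s * d^3 = s'"
    and "3 * p * a^2 * u + q * (a^2 * v + 2 * a * u * c) + r * (u * c^2 + 2 * a * c * v) + 3 * s * c^2 * v
      + \<alpha> * a^2 + \<beta> * a * c + \<gamma> * c^2 = \<alpha>'"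
    and "6 * p * a * b * u + q * (2 * a * b * v + 2 * a * u * d + 2 * b * u * c)
      + r * (2 * u * c * d + 2 * a * d * v + 2 * b * c * v) + 6 * s * c * d * v
      + 2 * \<alpha> * a * b + \<beta> * (a * d + b * c) + 2 * \<gamma> * c * d = \<beta>'"
    and "3 * p * b^2 * u + q * (b^2 * v + 2 * b * u * d) + r * (u * d^2 + 2 * b * d * v) + 3 * s * d^2 * v
      + \<alpha> * b^2 + \<beta> * b * d + \<gamma> * d^2 = \<gamma>'"
  shows "\<exists>H' I' J'. subst_equiv (cubic p q r s \<alpha> \<beta> \<gamma> H I J) (cubic p' q' r' s' \<alpha>' \<beta>' \<gamma>' H' I' J')"
  by (intro exI, rule subst_equiv_cubicI[where k = 1 and u = u and v = v, OF assms(1)])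
     (simp_all only: assms mult_1 one_neq_zero not_False_eq_True)

lemma subst_equiv_cubic_lead:
  assumes "a * d - b * c \<noteq> 0" "k \<noteq> 0"
    and "p * a^3 + q * a^2 * c + r * a * c^2 + s * c^3 = k * p'"
    and "3 * p * a^2 * b + q * (a^2 * d + 2 * a * b * c) + r * (b * c^2 + 2 * a * c * d)
      + 3 * s * c^2 * d = k * q'"
    and "3 * p * a * b^2 + q * (b^2 * c + 2 * a * b * d) + r * (a * d^2 + 2 * b * c * d)
      + 3 * s * c * d^2 = k * r'"
    and "p * b^3 + q * b^2 * d + r * b * d^2 + s * d^3 = k * s'"
  shows "\<exists>\<alpha>' \<beta>' \<gamma>' H' I' J'.
    subst_equiv (cubic p q r s \<alpha> \<beta> \<gamma> H I J) (cubic p' q' r' s' \<alpha>' \<beta>' \<gamma>' H' I' J')"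
  by (intro exI, rule subst_equiv_cubicI[where u = 0 and v = 0, OF assms])
    (rule nonzero_eq_divide_eq[OF assms(2), THEN iffD1, OF refl, symmetric, unfolded mult.commute[of _ k]])+

lemma subst_equiv_translate:
  "\<exists>H' I' J'. subst_equiv (cubic p q r s \<alpha> \<beta> \<gamma> H I J)
     (cubic p q r s (\<alpha> + 3 * p * u + q * v) (\<beta> + 2 * q * u + 2 * r * v) (\<gamma> + r * u + 3 * s * v) H' I' J')"
  by (rule subst_equiv_cubic_quadratic[where a = 1 and b = 0 and c = 0 and d = 1 and u = u and v = v])
     (simp_all add: algebra_simps)

lemma subst_equiv_diag:
  assumes "a \<noteq> 0" "d \<noteq> 0" "k \<noteq> 0"
    and "p * a^3 = k * p'" "q * a^2 * d = k * q'" "r * a * d^2 = k * r'" "s * d^3 = k * s'"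
    and "\<alpha> * a^2 = k * \<alpha>'" "\<beta> * a * d = k * \<beta>'" "\<gamma> * d^2 = k * \<gamma>'"
    and "H * a = k * H'" "I * d = k * I'" "J = k * J'"
  shows "subst_equiv (cubic p q r s \<alpha> \<beta> \<gamma> H I J) (cubic p' q' r' s' \<alpha>' \<beta>' \<gamma>' H' I' J')"
  by (rule subst_equiv_cubicI[where a = a and b = 0 and c = 0 and d = d and u = 0 and v = 0 and k = k])
     (use assms in \<open>simp_all add: algebra_simps\<close>)

section \<open>Reduction of the cubic part\<close>

text \<open>Making a coefficient of weight two \<open>1\<close> or \<open>-1\<close> fixes only
  \<open>a^2\<close>; the free sign of \<open>a\<close> is spent on \<open>t / a\<close>, which
  yields the sign condition on the constant term.\<close>

lemma exists_square_abs:
  fixes I t :: real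
  assumes "I \<noteq> 0"
  obtains a where "a \<noteq> 0" "a^2 = \<bar>I\<bar>" "t / a \<ge> 0"
proof (cases "t \<ge> 0")
  case True
  then show ?thesis using assms by (intro that[of "sqrt \<bar>I\<bar>"]) auto
next
  case False
  then show ?thesis using assms
    by (intro that[of "- sqrt \<bar>I\<bar>"]) (auto simp: divide_nonpos_nonneg)
qed

lemma exists_cube_root:
  fixes J :: real
  assumes "J \<noteq> 0"
  obtains a where "a \<noteq> 0" "a^3 = J"
  using assms odd_real_root_pow[of 3 J] by (intro that[of "root 3 J"]) auto

lemma exists_fourth_root_abs:
  fixes J :: real
  assumes "J \<noteq> 0"
  obtains a where "a \<noteq> 0" "a^4 = \<bar>J\<bar>"
  using assms real_root_pow_pos2[of 4 "\<bar>J\<bar>"] by (intro that[of "root 4 \<bar>J\<bar>"]) auto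

lemma exists_sixth_root_abs:
  fixes J :: real
  assumes "J \<noteq> 0"
  obtains a where "a \<noteq> 0" "a^6 = \<bar>J\<bar>"
  using assms real_root_pow_pos2[of 6 "\<bar>J\<bar>"] by (intro that[of "root 6 \<bar>J\<bar>"]) auto

lemma monic_cubic_root:
  fixes p q r :: real
  shows "\<exists>t. p + q * t + r * t^2 + t^3 = 0"
proof -
  \<comment> \<open>A Cauchy bound: at distance \<open>M\<close> from 0 the cube outweighs the other
    terms, so the value at \<open>- M\<close> is at most 0 and the value at \<open>M\<close> at
    least 0.\<close>
  define M where "M = 1 + \<bar>p\<bar> + \<bar>q\<bar> + \<bar>r\<bar>"
  have M: "M \<ge> 1" by (simp add: M_def)
  have "M \<le> M^2" using M by (simp add: self_le_power)
  have "\<bar>p\<bar> \<le> \<bar>p\<bar> * M^2"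
    using M by (simp add: mult_le_cancel_left1)
  moreover have "\<bar>q\<bar> * M \<le> \<bar>q\<bar> * M^2"
    using \<open>M \<le> M^2\<close> by (simp add: mult_left_mono)
  ultimately have "\<bar>p\<bar> + \<bar>q\<bar> * M + \<bar>r\<bar> * M^2 \<le> (M - 1) * M^2"
    by (simp add: M_def algebra_simps)
  also have "\<dots> \<le> M^3"
    using M by (simp add: algebra_simps power2_eq_square power3_eq_cube)
  finally have bound: "\<bar>p\<bar> + \<bar>q\<bar> * M + \<bar>r\<bar> * M^2 \<le> M^3" .
  have abs: "\<bar>q * M\<bar> = \<bar>q\<bar> * M" "\<bar>r * M^2\<bar> = \<bar>r\<bar> * M^2"
    using M by (simp_all add: abs_mult)
  have "p + q * (-M) + r * (-M)^2 + (-M)^3 \<le> 0"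
    using bound abs by simp
  moreover have "0 \<le> p + q * M + r * M^2 + M^3"
    using bound abs by linarith
  ultimately show ?thesis
    using IVT'[of "\<lambda>t. p + q * t + r * t^2 + t^3" "-M" 0 M] M
    by (fastforce intro!: continuous_intros)
qed

definition canonical_leads :: "(real \<times> real \<times> real \<times> real) set" where
  "canonical_leads = {(1, 0, 1, 0), (1, 0, -1, 0), (0, 1, 0, 0), (1, 0, 0, 0)}"

text \<open>The lower coefficients are quantified inside, so a change of coordinates is judged by
  its effect on the cubic part alone and such changes can be chained.\<close>

definition reducible_lead :: "real \<Rightarrow> real \<Rightarrow> real \<Rightarrow> real \<Rightarrow> bool" where
  "reducible_lead p q r s \<longleftrightarrow> (\<forall>\<alpha> \<beta> \<gamma> H I J. \<exists>p' q' r' s' \<alpha>' \<beta>' \<gamma>' H' I' J'.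
     (p', q', r', s') \<in> canonical_leads \<and>
     subst_equiv (cubic p q r s \<alpha> \<beta> \<gamma> H I J) (cubic p' q' r' s' \<alpha>' \<beta>' \<gamma>' H' I' J'))"

lemma reducible_lead_canonical:
  assumes "(p, q, r, s) \<in> canonical_leads"
  shows "reducible_lead p q r s"
  unfolding reducible_lead_def using assms subst_equiv_refl by blast

lemma reducible_lead_step:
  assumes "a * d - b * c \<noteq> 0" "k \<noteq> 0"
    and "p * a^3 + q * a^2 * c + r * a * c^2 + s * c^3 = k * p'"
    and "3 * p * a^2 * b + q * (a^2 * d + 2 * a * b * c) + r * (b * c^2 + 2 * a * c * d)
      + 3 * s * c^2 * d = k * q'"
    and "3 * p * a * b^2 + q * (b^2 * c + 2 * a * b * d) + r * (a * d^2 + 2 * b * c * d)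
      + 3 * s * c * d^2 = k * r'"
    and "p * b^3 + q * b^2 * d + r * b * d^2 + s * d^3 = k * s'"
    and "reducible_lead p' q' r' s'"
  shows "reducible_lead p q r s"
  unfolding reducible_lead_def
proof (intro allI)
  fix \<alpha> \<beta> \<gamma> H I J
  obtain \<alpha>' \<beta>' \<gamma>' H' I' J' where 1:
    "subst_equiv (cubic p q r s \<alpha> \<beta> \<gamma> H I J) (cubic p' q' r' s' \<alpha>' \<beta>' \<gamma>' H' I' J')"
    using subst_equiv_cubic_lead[OF assms(1-6)] by blast
  obtain p'' q'' r'' s'' \<alpha>'' \<beta>'' \<gamma>'' H'' I'' J'' where 2: "(p'', q'', r'', s'') \<in> canonical_leads"
    "subst_equiv (cubic p' q' r' s' \<alpha>' \<beta>' \<gamma>' H' I' J') (cubic p'' q'' r'' s'' \<alpha>'' \<beta>'' \<gamma>'' H'' I'' J'')"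
    using assms(7)[unfolded reducible_lead_def, rule_format, of \<alpha>' \<beta>' \<gamma>' H' I' J'] by blast
  show "\<exists>p' q' r' s' \<alpha>' \<beta>' \<gamma>' H' I' J'. (p', q', r', s') \<in> canonical_leads \<and>
     subst_equiv (cubic p q r s \<alpha> \<beta> \<gamma> H I J) (cubic p' q' r' s' \<alpha>' \<beta>' \<gamma>' H' I' J')"
    using subst_equiv_trans[OF 1 2(2)] 2(1) by blast
qed

lemma reducible_lead_no_y3:
  assumes "p \<noteq> 0 \<or> q \<noteq> 0 \<or> r \<noteq> 0"
  shows "reducible_lead p q r 0"
proof -
  have canonical: "reducible_lead 1 0 1 0" "reducible_lead 1 0 (-1) 0" "reducible_lead 0 1 0 0"
    "reducible_lead 1 0 0 0"
    by (simp_all add: reducible_lead_canonical canonical_leads_def)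
  consider "r \<noteq> 0" | "r = 0" "q \<noteq> 0" | "r = 0" "q = 0" "p \<noteq> 0" using assms by blast
  then show ?thesis
  proof cases
    case 1
    \<comment> \<open>Completing the square in \<open>y\<close> gives
      \<open>x (P x^2 + r y^2)\<close>. The sign of \<open>P / r\<close> decides between one real
      line and three; for \<open>P = 0\<close> exchanging the variables gives
      \<open>x^2 y\<close>.\<close>
    define P where "P = p - q^2 / (4 * r)"
    have "reducible_lead P 0 r 0"
    proof (cases "P = 0")
      case True
      show ?thesis
        by (rule reducible_lead_step[where a = 0 and b = 1 and c = 1 and d = 0 and k = r, OF _ _ _ _ _ _ canonical(3)])
           (use True 1 in simp_all)
    next
      case False
      define w where "w = sqrt \<bar>P / r\<bar>"
      have w: "w \<noteq> 0" "w^2 = \<bar>P / r\<bar>" using 1 False by (simp_all add: w_def)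
      show ?thesis
      proof (cases "P / r > 0")
        case True
        then have "r * w^2 = P" using 1 by (simp add: w abs_of_pos del: abs_divide)
        then show ?thesis
          using False w(1)
          by (intro reducible_lead_step[where a = 1 and b = 0 and c = 0 and d = w and k = P, OF _ _ _ _ _ _ canonical(1)])
             simp_all
      next
        case F: False
        then have "r * w^2 = - P" using 1 by (simp add: w abs_of_nonpos del: abs_divide)
        then show ?thesis
          using False w(1)
          by (intro reducible_lead_step[where a = 1 and b = 0 and c = 0 and d = w and k = P, OF _ _ _ _ _ _ canonical(2)])
             simp_all
      qed
    qed
    then show ?thesis
      by (rule reducible_lead_step[where a = 1 and b = 0 and c = "- q / (2 * r)" and d = 1 and k = 1, rotated 6])
         (use 1 in \<open>simp_all add: P_def field_simps power2_eq_square\<close>)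
  next
    case 2
    show ?thesis
      by (rule reducible_lead_step[where a = 1 and b = 0 and c = "- p / q" and d = "1 / q" and k = 1, OF _ _ _ _ _ _ canonical(3)])
         (use 2 in simp_all)
  next
    case 3
    show ?thesis
      by (rule reducible_lead_step[where a = 1 and b = 0 and c = 0 and d = 1 and k = p, OF _ _ _ _ _ _ canonical(4)])
         (use 3 in simp_all)
  qed
qed

lemma reducible_lead_nonzero:
  assumes "p \<noteq> 0 \<or> q \<noteq> 0 \<or> r \<noteq> 0 \<or> s \<noteq> 0"
  shows "reducible_lead p q r s"
proof (cases "s = 0")
  case True
  then show ?thesis using reducible_lead_no_y3 assms by blast
next
  case False
  \<comment> \<open>The form vanishes on the direction \<open>(1, t)\<close>. The substitution
    \<open>(y, x + t y)\<close> below turns it into the direction of \<open>y\<close>, so the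
    \<open>y^3\<close> term disappears.\<close>
  obtain t where "p / s + q / s * t + r / s * t^2 + t^3 = 0"
    using monic_cubic_root by blast
  then have "s * (p / s + q / s * t + r / s * t^2 + t^3) = 0"
    by simp
  then have t: "p + q * t + r * t^2 + s * t^3 = 0"
    using False by (simp add: distrib_left)
  have "reducible_lead s (r + 3 * s * t) (q + 2 * r * t + 3 * s * t^2) 0"
    using reducible_lead_no_y3 False by blast
  then show ?thesis
    by (rule reducible_lead_step[where a = 0 and b = 1 and c = 1 and d = t and k = 1, rotated 6])
       (use t in \<open>simp_all add: algebra_simps\<close>)
qed

section \<open>Reduction to normal forms\<close>

text \<open>\<open>nf1\<close> to \<open>nf4\<close> express membership in the four sublists by the
  coefficients that are not cleared; \<open>L1_eq\<close> to \<open>L4_eq\<close> verify the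
  match.\<close>

definition nf1 :: "real \<Rightarrow> real \<Rightarrow> real \<Rightarrow> real \<Rightarrow> bool" where
  "nf1 \<alpha> H I J \<longleftrightarrow> \<alpha> = 1 \<and> I \<ge> 0 \<or> \<alpha> = 0 \<and> I = 1 \<and> J \<ge> 0 \<or>
     \<alpha> = 0 \<and> I = 0 \<and> H \<in> {1, -1} \<and> J \<ge> 0 \<or> \<alpha> = 0 \<and> I = 0 \<and> H = 0 \<and> J \<in> {1, 0}"

definition nf2 :: "real \<Rightarrow> real \<Rightarrow> real \<Rightarrow> real \<Rightarrow> bool" where
  "nf2 \<gamma> H I J \<longleftrightarrow> \<gamma> = -1 \<and> I \<ge> 0 \<and> H + I \<le> - 3 / 4 \<or> \<gamma> = 0 \<and> I = -1 \<and> H \<in> {-1..1} \<and> J \<ge> 0 \<or>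
     \<gamma> = 0 \<and> I = 0 \<and> H = 0 \<and> J \<in> {1, 0}"

definition nf3 :: "real \<Rightarrow> real \<Rightarrow> real \<Rightarrow> real \<Rightarrow> bool" where
  "nf3 \<gamma> H I J \<longleftrightarrow> \<gamma> = 1 \<and> H = -1 \<or> \<gamma> = 1 \<and> H = 0 \<and> I \<in> {1, -1} \<or>
     \<gamma> = 1 \<and> H = 0 \<and> I = 0 \<and> J \<in> {1, -1, 0} \<or>
     \<gamma> = 0 \<and> H = -1 \<and> I \<in> {1, -1} \<and> J \<ge> 0 \<or> \<gamma> = 0 \<and> H = 0 \<and> I \<in> {1, -1} \<and> J \<in> {1, 0} \<or>
     \<gamma> = 0 \<and> H = -1 \<and> I = 0 \<and> J \<in> {1, 0} \<or> \<gamma> = 0 \<and> H = 0 \<and> I = 0 \<and> J \<in> {-1, 0}"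

definition nf4 :: "real \<Rightarrow> real \<Rightarrow> real \<Rightarrow> real \<Rightarrow> real \<Rightarrow> bool" where
  "nf4 \<beta> \<gamma> H I J \<longleftrightarrow> \<beta> = 0 \<and> \<gamma> = -1 \<and> H \<in> {1, -1} \<and> I = 0 \<or>
     \<beta> = 0 \<and> \<gamma> = -1 \<and> H = 0 \<and> I = 0 \<and> J \<in> {1, -1, 0} \<or>
     \<beta> = 0 \<and> \<gamma> = 0 \<and> H = 0 \<and> I = -1 \<and> J = 0 \<or> \<beta> = -1 \<and> \<gamma> = 0 \<and> H = 0 \<and> I = 0 \<and> J \<in> {1, 0} \<or>
     \<beta> = 0 \<and> \<gamma> = 0 \<and> H \<in> {1, -1} \<and> I = 0 \<and> J \<ge> 0 \<or> \<beta> = 0 \<and> \<gamma> = 0 \<and> H = 0 \<and> I = 0 \<and> J \<in> {1, 0}"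

text \<open>A translation clears \<open>xy\<close> and \<open>y^2\<close>. Scaling by
  \<open>a\<close> and \<open>d = a\<close> or \<open>d = - a\<close>, with factor
  \<open>a^3\<close>, turns the others into \<open>\<alpha> / a\<close>, \<open>H / a^2\<close>,
  \<open>I / a^2\<close> up to sign, and \<open>J / a^3\<close>. The first nonzero one of
  \<open>\<alpha>\<close>, \<open>I\<close>, \<open>H\<close>, \<open>J\<close> determines
  \<open>a\<close> up to sign at least, and the sign of \<open>d\<close> serves to adjust
  \<open>I\<close>.\<close>

lemma nf1_exists:
  "\<exists>\<alpha>' H' I' J'. nf1 \<alpha>' H' I' J' \<and>
     subst_equiv (cubic 1 0 1 0 \<alpha> \<beta> \<gamma> H I J) (cubic 1 0 1 0 \<alpha>' 0 0 H' I' J')"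
proof -
  have scale: "\<exists>\<alpha>' H' I' J'. nf1 \<alpha>' H' I' J' \<and>
     subst_equiv (cubic 1 0 1 0 \<alpha> 0 0 H I J) (cubic 1 0 1 0 \<alpha>' 0 0 H' I' J')" for \<alpha> H I J
  proof -
    consider "\<alpha> \<noteq> 0" | "\<alpha> = 0" "I \<noteq> 0" | "\<alpha> = 0" "I = 0" "H \<noteq> 0" | "\<alpha> = 0" "I = 0" "H = 0" "J \<noteq> 0"
      | "\<alpha> = 0" "I = 0" "H = 0" "J = 0" by blast
    then show ?thesis
    proof cases
      case 1
      define d where "d = (if I \<ge> 0 then \<alpha> else - \<alpha>)"
      have d: "d \<noteq> 0" "d^2 = \<alpha>^2" "I * d / \<alpha>^3 = \<bar>I\<bar> / \<alpha>^2"
        using 1 by (auto simp: d_def power2_eq_square power3_eq_cube)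
      show ?thesis
        by (rule exI[of _ 1], rule exI[of _ "H / \<alpha>^2"], rule exI[of _ "I * d / \<alpha>^3"], rule exI[of _ "J / \<alpha>^3"],
            rule conjI, simp add: nf1_def d, rule subst_equiv_diag[where a = \<alpha> and d = d and k = "\<alpha>^3"])
           (use 1 d in \<open>simp_all add: field_simps power2_eq_square power3_eq_cube\<close>)
    next
      case 2
      obtain a where a: "a \<noteq> 0" "a^2 = \<bar>I\<bar>" "J / a \<ge> 0" using exists_square_abs[OF 2(2)] .
      have a3: "a^3 = a * \<bar>I\<bar>" using a(2) by (simp add: power3_eq_cube power2_eq_square)
      have "J / a^3 \<ge> 0" using divide_nonneg_nonneg[OF a(3), of "\<bar>I\<bar>"] by (simp add: a3)
      then show ?thesis
        by (intro exI[of _ 0] exI[of _ "H / a^2"] exI[of _ 1] exI[of _ "J / a^3"] conjI, simp add: nf1_def)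
           (rule subst_equiv_diag[where a = a and d = "a * sgn I" and k = "a^3"],
            use 2 a in \<open>simp_all add: a3 sgn_if power_mult_distrib field_simps\<close>)
    next
      case 3
      obtain a where a: "a \<noteq> 0" "a^2 = \<bar>H\<bar>" "J / a \<ge> 0" using exists_square_abs[OF 3(3)] .
      have a3: "a^3 = a * \<bar>H\<bar>" using a(2) by (simp add: power3_eq_cube power2_eq_square)
      have "J / a^3 \<ge> 0" using divide_nonneg_nonneg[OF a(3), of "\<bar>H\<bar>"] by (simp add: a3)
      have "subst_equiv (cubic 1 0 1 0 \<alpha> 0 0 H I J) (cubic 1 0 1 0 0 0 0 (sgn H) 0 (J / a^3))"
        by (rule subst_equiv_diag[where a = a and d = a and k = "a^3"])
           (use 3 a in \<open>simp_all add: a3 sgn_if field_simps\<close>)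
      moreover have "nf1 0 (sgn H) 0 (J / a^3)"
        using 3 \<open>J / a^3 \<ge> 0\<close> by (simp add: nf1_def sgn_if)
      ultimately show ?thesis by blast
    next
      case 4
      obtain a where a: "a \<noteq> 0" "a^3 = J" using exists_cube_root[OF 4(4)] .
      have "subst_equiv (cubic 1 0 1 0 \<alpha> 0 0 H I J) (cubic 1 0 1 0 0 0 0 0 0 1)"
        by (rule subst_equiv_diag[where a = a and d = a and k = "a^3"])
           (use 4 a in \<open>simp_all add: power2_eq_square power3_eq_cube\<close>)
      then show ?thesis by (intro exI conjI[rotated], assumption) (auto simp: nf1_def)
    next
      case 5
      show ?thesis by (intro exI conjI[rotated], rule subst_equiv_refl) (use 5 in \<open>simp add: nf1_def\<close>)
    qed
  qed
  obtain \<alpha>' H' I' J' where "subst_equiv (cubic 1 0 1 0 \<alpha> \<beta> \<gamma> H I J) (cubic 1 0 1 0 \<alpha>' 0 0 H' I' J')"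
    using subst_equiv_translate[of 1 0 1 0 \<alpha> \<beta> \<gamma> H I J "- \<gamma>" "- \<beta> / 2"] by auto
  with scale show ?thesis by (meson subst_equiv_trans)
qed


text \<open>A translation clears \<open>x^2\<close> and \<open>xy\<close>, so
  \<open>\<gamma>\<close> survives. Two reflections generate the permutations of the lines; the
  parameters are moved into a chamber after scaling if \<open>\<gamma>\<close> is nonzero, before
  scaling otherwise.\<close>

lemma nf2_exists:
  "\<exists>\<gamma>' H' I' J'. nf2 \<gamma>' H' I' J' \<and>
     subst_equiv (cubic 1 0 (-1) 0 \<alpha> \<beta> \<gamma> H I J) (cubic 1 0 (-1) 0 0 0 \<gamma>' H' I' J')"
proof -
  let ?F = "\<lambda>\<gamma> H I J. cubic 1 0 (-1) 0 0 0 \<gamma> H I J"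
  have reflect: "subst_equiv (?F \<gamma> H I J) (?F \<gamma> H (- I) J)" for \<gamma> H I J
    by (rule subst_equiv_diag[where a = 1 and d = "-1" and k = 1]) simp_all
  \<comment> \<open>The matrix is the involution that exchanges the lines \<open>x = 0\<close> and
    \<open>x + y = 0\<close> and preserves \<open>x = y\<close>.\<close>
  have reflect0: "subst_equiv (?F 0 H I J) (?F 0 ((- H - 3 * I) / 2) ((- H + I) / 2) J)" for H I J
    by (rule subst_equiv_cubicI[where a = "- 1 / 2" and b = "- 1 / 2" and c = "- 3 / 2" and d = "1 / 2"
          and u = 0 and v = 0 and k = 1])
       (simp_all add: field_simps power2_eq_square power3_eq_cube)
  \<comment> \<open>The same matrix, with the translation that fixes the centroid
    \<open>(-1/2, 0)\<close> of the triangle. In the coordinates \<open>(H + 3 / 4, I)\<close> it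
    acts as \<open>reflect0\<close> does on \<open>(H, I)\<close>.\<close>
  have reflect1: "subst_equiv (?F (-1) H I J)
      (?F (-1) ((- (H + 3 / 4) - 3 * I) / 2 - 3 / 4) ((- (H + 3 / 4) + I) / 2)
         (J + (- 3 * (H + 3 / 4) - 3 * I) / 4))" for H I J
    by (rule subst_equiv_cubicI[where a = "- 1 / 2" and b = "- 1 / 2" and c = "- 3 / 2" and d = "1 / 2"
          and u = "- 3 / 4" and v = "- 3 / 4" and k = 1])
       (simp_all add: field_simps power2_eq_square power3_eq_cube)
  \<comment> \<open>The point \<open>H = -3/4, I = 0\<close> is fixed by the \<open>S\<^sub>3\<close>-action when the coefficient of \<open>y\<^sup>2\<close> is \<open>-1\<close>.\<close>
  have with_quadratic: "\<exists>H' I' J'. I' \<ge> 0 \<and> H' + I' \<le> - 3 / 4 \<and> subst_equiv (?F (-1) H I J) (?F (-1) H' I' J')"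
    for H I J
  proof -
    have upper: "\<exists>H' I' J'. I' \<ge> 0 \<and> H' + I' \<le> - 3 / 4 \<and> subst_equiv (?F (-1) H I J) (?F (-1) H' I' J')"
      if "I \<ge> 0" for H I J
    proof -
      define h where "h = H + 3 / 4"
      \<comment> \<open>The mirrors cut the half plane \<open>I \<ge> 0\<close> into three sectors:
        the chamber itself, its neighbour (one reflection away) and the far one (two reflections
        away).\<close>
      consider "h + I \<le> 0" | "h + I > 0" "I \<ge> h" | "h + I > 0" "I < h" by linarith
      then show ?thesis
      proof cases
        case 1
        then have "H + I \<le> - 3 / 4" by (simp add: h_def)
        then show ?thesis using that subst_equiv_refl by blast
      next
        case 2
        have "(- h + I) / 2 \<ge> 0" "(- h - 3 * I) / 2 - 3 / 4 + (- h + I) / 2 \<le> - 3 / 4"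
          using 2 by (simp_all add: field_simps)
        then show ?thesis using reflect1[of H I J] unfolding h_def by blast
      next
        case 3
        have "- ((- h + I) / 2) \<ge> 0" "(- h - 3 * I) / 2 - 3 / 4 + - ((- h + I) / 2) \<le> - 3 / 4"
          using 3 that by (simp_all add: field_simps)
        then show ?thesis
          using subst_equiv_trans[OF reflect1[of H I J] reflect] unfolding h_def by blast
      qed
    qed
    show ?thesis
    proof (cases "I \<ge> 0")
      case False
      then have "- I \<ge> 0" by simp
      from upper[OF this] show ?thesis using subst_equiv_trans[OF reflect] by blast
    qed (rule upper)
  qed
  \<comment> \<open>A different chamber from the one above: here \<open>I'\<close> vanishes only at
    the origin, so otherwise it can be scaled to \<open>-1\<close>. The reflections leave
    \<open>J\<close> unchanged.\<close>
  have chamber: "\<exists>H' I'. \<bar>H'\<bar> \<le> - I' \<and> subst_equiv (?F 0 H I J) (?F 0 H' I' J)" for H I J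
  proof -
    have lower: "\<exists>H' I'. \<bar>H'\<bar> \<le> - I' \<and> subst_equiv (?F 0 H I J) (?F 0 H' I' J)" if "I \<le> 0" for H I
    proof -
      consider "\<bar>H\<bar> \<le> - I" | "H > - I" | "H < I" using that by linarith
      then show ?thesis
      proof cases
        case 1
        then show ?thesis using subst_equiv_refl by blast
      next
        case 2
        have "\<bar>(- H - 3 * I) / 2\<bar> \<le> - ((- H + I) / 2)" using 2 that by (simp add: abs_le_iff field_simps)
        then show ?thesis using reflect0 by blast
      next
        case 3
        have "\<bar>(- H - 3 * - I) / 2\<bar> \<le> - (- ((- H + - I) / 2))" using 3 that by (simp add: abs_le_iff field_simps)
        then show ?thesis
          using subst_equiv_trans[OF reflect subst_equiv_trans[OF reflect0 reflect]] by blast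
      qed
    qed
    show ?thesis
    proof (cases "I \<le> 0")
      case False
      then have "- I \<le> 0" by simp
      from lower[OF this] show ?thesis using subst_equiv_trans[OF reflect] by blast
    qed (rule lower)
  qed
  have scale: "\<exists>\<gamma>' H' I' J'. nf2 \<gamma>' H' I' J' \<and> subst_equiv (?F \<gamma> H I J) (?F \<gamma>' H' I' J')" for \<gamma> H I J
  proof (cases "\<gamma> = 0")
    case False
    have "subst_equiv (?F \<gamma> H I J) (?F (-1) (H / \<gamma>^2) (I / \<gamma>^2) (- J / \<gamma>^3))"
      by (rule subst_equiv_diag[where a = "- \<gamma>" and d = "- \<gamma>" and k = "- (\<gamma>^3)"])
         (use False in \<open>simp_all add: field_simps power2_eq_square power3_eq_cube\<close>)
    moreover obtain H' I' J' where "nf2 (-1) H' I' J'"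
      "subst_equiv (?F (-1) (H / \<gamma>^2) (I / \<gamma>^2) (- J / \<gamma>^3)) (?F (-1) H' I' J')"
      using with_quadratic[of "H / \<gamma>^2" "I / \<gamma>^2" "- J / \<gamma>^3"] unfolding nf2_def by blast
    ultimately show ?thesis by (meson subst_equiv_trans)
  next
    case True
    obtain H' I' where *: "\<bar>H'\<bar> \<le> - I'" "subst_equiv (?F \<gamma> H I J) (?F 0 H' I' J)"
      using chamber True by blast
    consider "I' \<noteq> 0" | "I' = 0" "H' = 0" "J \<noteq> 0" | "I' = 0" "H' = 0" "J = 0" using *(1) by fastforce
    then have "\<exists>\<gamma>'' H'' I'' J''. nf2 \<gamma>'' H'' I'' J'' \<and> subst_equiv (?F 0 H' I' J) (?F \<gamma>'' H'' I'' J'')"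
    proof cases
      case 1
      then have "I' < 0" using *(1) by linarith
      obtain a where a: "a \<noteq> 0" "a^2 = \<bar>I'\<bar>" "J / a \<ge> 0" using exists_square_abs[OF 1] .
      have a3: "a^3 = a * \<bar>I'\<bar>" using a(2) by (simp add: power3_eq_cube power2_eq_square)
      have "J / a^3 \<ge> 0" using divide_nonneg_nonneg[OF a(3), of "\<bar>I'\<bar>"] by (simp add: a3)
      moreover have S: "subst_equiv (?F 0 H' I' J) (?F 0 (H' / \<bar>I'\<bar>) (-1) (J / a^3))"
        by (rule subst_equiv_diag[where a = a and d = a and k = "a^3"])
           (use \<open>I' < 0\<close> a in \<open>simp_all add: a3 field_simps\<close>)
      moreover have "H' / \<bar>I'\<bar> \<in> {-1..1}"
        using *(1) \<open>I' < 0\<close> by (simp add: field_simps abs_le_iff)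
      ultimately have "nf2 0 (H' / \<bar>I'\<bar>) (-1) (J / a^3)" by (simp add: nf2_def)
      with S show ?thesis by blast
    next
      case 2
      obtain a where a: "a \<noteq> 0" "a^3 = J" using exists_cube_root[OF 2(3)] .
      have "subst_equiv (?F 0 H' I' J) (?F 0 0 0 1)"
        by (rule subst_equiv_diag[where a = a and d = a and k = "a^3"])
           (use 2 a in \<open>simp_all add: power2_eq_square power3_eq_cube\<close>)
      then show ?thesis by (intro exI conjI[rotated], assumption) (auto simp: nf2_def)
    next
      case 3
      show ?thesis by (intro exI conjI[rotated], rule subst_equiv_refl) (use 3 in \<open>simp add: nf2_def\<close>)
    qed
    then show ?thesis using *(2) by (meson subst_equiv_trans)
  qed
  obtain \<gamma>' H' I' J' where "subst_equiv (cubic 1 0 (-1) 0 \<alpha> \<beta> \<gamma> H I J) (?F \<gamma>' H' I' J')"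
    using subst_equiv_translate[of 1 0 "-1" 0 \<alpha> \<beta> \<gamma> H I J "- \<alpha> / 3" "\<beta> / 2"] by auto
  with scale show ?thesis by (meson subst_equiv_trans)
qed

text \<open>The axes can be scaled independently by \<open>a\<close> and \<open>b\<close>. A
  \<open>y^2\<close> term ties them by \<open>b = a^2\<close>, so that \<open>H\<close>,
  \<open>I\<close>, \<open>J\<close> have weights 3, 2, 4. Without it the weights are
  \<open>a b\<close>, \<open>a^2\<close>, \<open>a^2 b\<close>: only \<open>I\<close> keeps a sign,
  and a continuous \<open>J\<close> is left only if \<open>H\<close> and \<open>I\<close> are both
  nonzero.\<close>

lemma nf3_exists:
  "\<exists>\<gamma>' H' I' J'. nf3 \<gamma>' H' I' J' \<and>
     subst_equiv (cubic 0 1 0 0 \<alpha> \<beta> \<gamma> H I J) (cubic 0 1 0 0 0 0 \<gamma>' H' I' J')"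
proof -
  let ?F = "\<lambda>\<gamma> H I J. cubic 0 1 0 0 0 0 \<gamma> H I J"
  have diag: "subst_equiv (?F \<gamma> H I J) (?F \<gamma>' H' I' J')"
    if "a \<noteq> 0" "b \<noteq> 0" "\<gamma> * b = a^2 * \<gamma>'" "H = a * b * H'" "I = a^2 * I'" "J = a^2 * b * J'"
    for a b \<gamma> H I J \<gamma>' H' I' J'
    by (rule subst_equiv_diag[where a = a and d = b and k = "a^2 * b"])
       (use that in \<open>simp_all add: power2_eq_square algebra_simps\<close>)
  have with_quadratic: "\<exists>\<gamma>' H' I' J'. nf3 \<gamma>' H' I' J' \<and> subst_equiv (?F 1 H I J) (?F \<gamma>' H' I' J')" for H I J
  proof -
    consider "H \<noteq> 0" | "H = 0" "I \<noteq> 0" | "H = 0" "I = 0" "J \<noteq> 0" | "H = 0" "I = 0" "J = 0" by blast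
    then show ?thesis
    proof cases
      case 1
      then obtain a where a: "a \<noteq> 0" "a^3 = - H" using exists_cube_root[of "- H"] by auto
      have "subst_equiv (?F 1 H I J) (?F 1 (-1) (I / a^2) (J / a^4))"
        by (rule diag[of a "a^2"]) (use a in \<open>simp_all flip: power_add power_Suc\<close>)
      then show ?thesis by (intro exI conjI[rotated], assumption) (auto simp: nf3_def)
    next
      case 2
      obtain a where a: "a \<noteq> 0" "a^2 = \<bar>I\<bar>" using exists_square_abs[OF 2(2)] .
      have "subst_equiv (?F 1 H I J) (?F 1 0 (sgn I) (J / I^2))"
        by (rule diag[of a "a^2"]) (use 2 a(1) in \<open>simp_all add: a(2) sgn_if\<close>, simp add: power2_eq_square)
      moreover have "nf3 1 0 (sgn I) (J / I^2)" using 2 by (simp add: nf3_def sgn_if)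
      ultimately show ?thesis by blast
    next
      case 3
      obtain a where a: "a \<noteq> 0" "a^4 = \<bar>J\<bar>" using exists_fourth_root_abs[OF 3(3)] .
      have "subst_equiv (?F 1 H I J) (?F 1 0 0 (sgn J))"
        by (rule diag[of a "a^2"]) (use 3 a in \<open>simp_all add: sgn_if flip: power_add\<close>)
      then show ?thesis by (intro exI conjI[rotated], assumption) (use 3 in \<open>auto simp: nf3_def sgn_if\<close>)
    next
      case 4
      show ?thesis by (intro exI conjI[rotated], rule subst_equiv_refl) (use 4 in \<open>simp add: nf3_def\<close>)
    qed
  qed
  have without_quadratic: "\<exists>\<gamma>' H' I' J'. nf3 \<gamma>' H' I' J' \<and> subst_equiv (?F 0 H I J) (?F \<gamma>' H' I' J')" for H I J
  proof -
    consider "H \<noteq> 0" "I \<noteq> 0" | "H \<noteq> 0" "I = 0" "J \<noteq> 0" | "H \<noteq> 0" "I = 0" "J = 0"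
      | "H = 0" "I \<noteq> 0" "J \<noteq> 0" | "H = 0" "I \<noteq> 0" "J = 0" | "H = 0" "I = 0" "J \<noteq> 0"
      | "H = 0" "I = 0" "J = 0" by blast
    then show ?thesis
    proof cases
      case 1
      obtain a where a: "a \<noteq> 0" "a^2 = \<bar>I\<bar>" "- J / H / a \<ge> 0" using exists_square_abs[OF 1(2)] .
      have "subst_equiv (?F 0 H I J) (?F 0 (-1) (sgn I) (- J / H / a))"
        by (rule diag[of a "- H / a"]) (use 1 a in \<open>simp_all add: sgn_if power2_eq_square\<close>)
      then show ?thesis by (intro exI conjI[rotated], assumption) (use 1 a(3) in \<open>auto simp: nf3_def sgn_if\<close>)
    next
      case 2
      \<comment> \<open>The factors solve \<open>a b = - H\<close> and
        \<open>a^2 b = J\<close>.\<close>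
      have "subst_equiv (?F 0 H I J) (?F 0 (-1) 0 1)"
        by (rule diag[of "- J / H" "H^2 / J"]) (use 2 in \<open>simp_all add: power2_eq_square\<close>)
      then show ?thesis by (intro exI conjI[rotated], assumption) (auto simp: nf3_def)
    next
      case 3
      have "subst_equiv (?F 0 H I J) (?F 0 (-1) 0 0)"
        by (rule diag[of 1 "- H"]) (use 3 in simp_all)
      then show ?thesis by (intro exI conjI[rotated], assumption) (auto simp: nf3_def)
    next
      case 4
      obtain a where a: "a \<noteq> 0" "a^2 = \<bar>I\<bar>" using exists_square_abs[OF 4(2)] .
      have "subst_equiv (?F 0 H I J) (?F 0 0 (sgn I) 1)"
        by (rule diag[of a "J / a^2"]) (use 4 a(1) in \<open>simp_all add: a(2) sgn_if\<close>)
      then show ?thesis by (intro exI conjI[rotated], assumption) (use 4 in \<open>auto simp: nf3_def sgn_if\<close>)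
    next
      case 5
      obtain a where a: "a \<noteq> 0" "a^2 = \<bar>I\<bar>" using exists_square_abs[OF 5(2)] .
      have "subst_equiv (?F 0 H I J) (?F 0 0 (sgn I) 0)"
        by (rule diag[of a 1]) (use 5 a(1) in \<open>simp_all add: a(2) sgn_if\<close>)
      then show ?thesis by (intro exI conjI[rotated], assumption) (use 5 in \<open>auto simp: nf3_def sgn_if\<close>)
    next
      case 6
      have "subst_equiv (?F 0 H I J) (?F 0 0 0 (-1))"
        by (rule diag[of 1 "- J"]) (use 6 in simp_all)
      then show ?thesis by (intro exI conjI[rotated], assumption) (auto simp: nf3_def)
    next
      case 7
      show ?thesis by (intro exI conjI[rotated], rule subst_equiv_refl) (use 7 in \<open>simp add: nf3_def\<close>)
    qed
  qed
  have scale: "\<exists>\<gamma>' H' I' J'. nf3 \<gamma>' H' I' J' \<and> subst_equiv (?F \<gamma> H I J) (?F \<gamma>' H' I' J')" for \<gamma> H I J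
  proof (cases "\<gamma> = 0")
    case True
    then show ?thesis using without_quadratic by simp
  next
    case False
    have "subst_equiv (?F \<gamma> H I J) (?F 1 (H * \<gamma>) I (J * \<gamma>))"
      by (rule diag[of 1 "1 / \<gamma>"]) (use False in simp_all)
    then show ?thesis using with_quadratic by (meson subst_equiv_trans)
  qed
  obtain \<gamma>' H' I' J' where "subst_equiv (cubic 0 1 0 0 \<alpha> \<beta> \<gamma> H I J) (?F \<gamma>' H' I' J')"
    using subst_equiv_translate[of 0 1 0 0 \<alpha> \<beta> \<gamma> H I J "- \<beta> / 2" "- \<alpha>"] by auto
  with scale show ?thesis by (meson subst_equiv_trans)
qed

text \<open>Shears \<open>y + c x\<close> preserve \<open>x^3\<close>, so \<open>y\<close> may be
  replaced by any affine form involving it. The cases follow the highest power of \<open>y\<close>: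
  complete a square for \<open>y^2\<close>, absorb everything but a constant for \<open>xy\<close>,
  absorb the whole linear part for \<open>y\<close>; otherwise the cubic depends on \<open>x\<close>
  alone.\<close>

lemma nf4_exists:
  "\<exists>\<beta>' \<gamma>' H' I' J'. nf4 \<beta>' \<gamma>' H' I' J' \<and>
     subst_equiv (cubic 1 0 0 0 \<alpha> \<beta> \<gamma> H I J) (cubic 1 0 0 0 0 \<beta>' \<gamma>' H' I' J')"
proof -
  let ?F = "\<lambda>\<beta> \<gamma> H I J. cubic 1 0 0 0 0 \<beta> \<gamma> H I J"
  have diag: "subst_equiv (?F \<beta> \<gamma> H I J) (?F \<beta>' \<gamma>' H' I' J')"
    if "a \<noteq> 0" "d \<noteq> 0" "\<beta> * d = a^2 * \<beta>'" "\<gamma> * d^2 = a^3 * \<gamma>'" "H = a^2 * H'" "I * d = a^3 * I'" "J = a^3 * J'"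
    for a d \<beta> \<gamma> H I J \<beta>' \<gamma>' H' I' J'
    by (rule subst_equiv_diag[where a = a and d = d and k = "a^3"])
       (use that in \<open>simp_all add: power2_eq_square power3_eq_cube algebra_simps\<close>)
  have y2: "\<exists>\<beta>' \<gamma>' H' I' J'. nf4 \<beta>' \<gamma>' H' I' J' \<and> subst_equiv (?F 0 (-1) H 0 J) (?F \<beta>' \<gamma>' H' I' J')" for H J
  proof -
    consider "H \<noteq> 0" | "H = 0" "J \<noteq> 0" | "H = 0" "J = 0" by blast
    then show ?thesis
    proof cases
      case 1
      \<comment> \<open>Scalings preserving \<open>x^3 - y^2\<close> up to a factor satisfy
        \<open>a^3 = d^2\<close>, hence \<open>a = t^2\<close>, \<open>d = t^3\<close>. Then
        \<open>H\<close> and \<open>J\<close> have the even weights 4 and 6 in \<open>t\<close>, and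
        their signs persist.\<close>
      obtain t where t: "t \<noteq> 0" "t^4 = \<bar>H\<bar>" using exists_fourth_root_abs[OF 1] .
      have "subst_equiv (?F 0 (-1) H 0 J) (?F 0 (-1) (sgn H) 0 (J / t^6))"
        by (rule diag[of "t^2" "t^3"]) (use 1 t in \<open>simp_all add: sgn_if flip: power_mult\<close>)
      moreover have "nf4 0 (-1) (sgn H) 0 (J / t^6)" using 1 by (simp add: nf4_def sgn_if)
      ultimately show ?thesis by blast
    next
      case 2
      obtain t where t: "t \<noteq> 0" "t^6 = \<bar>J\<bar>" using exists_sixth_root_abs[OF 2(2)] .
      have "subst_equiv (?F 0 (-1) H 0 J) (?F 0 (-1) 0 0 (sgn J))"
        by (rule diag[of "t^2" "t^3"]) (use 2 t in \<open>simp_all add: sgn_if flip: power_mult\<close>)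
      then show ?thesis by (intro exI conjI[rotated], assumption) (use 2 in \<open>auto simp: nf4_def sgn_if\<close>)
    next
      case 3
      show ?thesis by (intro exI conjI[rotated], rule subst_equiv_refl) (use 3 in \<open>simp add: nf4_def\<close>)
    qed
  qed
  have x: "\<exists>\<beta>' \<gamma>' H' I' J'. nf4 \<beta>' \<gamma>' H' I' J' \<and> subst_equiv (?F 0 0 H 0 J) (?F \<beta>' \<gamma>' H' I' J')" for H J
  proof -
    consider "H \<noteq> 0" | "H = 0" "J \<noteq> 0" | "H = 0" "J = 0" by blast
    then show ?thesis
    proof cases
      case 1
      obtain a where a: "a \<noteq> 0" "a^2 = \<bar>H\<bar>" "J / a \<ge> 0" using exists_square_abs[OF 1] .
      have a3: "a^3 = a * \<bar>H\<bar>" using a(2) by (simp add: power3_eq_cube power2_eq_square)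
      have "J / a^3 \<ge> 0" using divide_nonneg_nonneg[OF a(3), of "\<bar>H\<bar>"] by (simp add: a3)
      have "subst_equiv (?F 0 0 H 0 J) (?F 0 0 (sgn H) 0 (J / a^3))"
        by (rule diag[of a 1]) (use 1 a in \<open>simp_all add: sgn_if\<close>)
      moreover from \<open>J / a^3 \<ge> 0\<close> have "nf4 0 0 (sgn H) 0 (J / a^3)"
        using 1 by (simp add: nf4_def sgn_if)
      ultimately show ?thesis by blast
    next
      case 2
      obtain a where a: "a \<noteq> 0" "a^3 = J" using exists_cube_root[OF 2(2)] .
      have "subst_equiv (?F 0 0 H 0 J) (?F 0 0 0 0 1)"
        by (rule diag[of a 1]) (use 2 a in simp_all)
      then show ?thesis by (intro exI conjI[rotated], assumption) (auto simp: nf4_def)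
    next
      case 3
      show ?thesis by (intro exI conjI[rotated], rule subst_equiv_refl) (use 3 in \<open>simp add: nf4_def\<close>)
    qed
  qed
  consider "\<gamma> \<noteq> 0" | "\<gamma> = 0" "\<beta> \<noteq> 0" | "\<gamma> = 0" "\<beta> = 0" by blast
  then show ?thesis
  proof cases
    case 1
    \<comment> \<open>The shear by \<open>c\<close> completes the square in \<open>y\<close>, and
      the translation by \<open>u\<close> removes the resulting \<open>x^2\<close> term.\<close>
    define c where "c = - \<beta> / (2 * \<gamma>)"
    define u where "u = - (\<alpha> + \<beta> * c + \<gamma> * c^2) / 3"
    have c: "\<beta> + 2 * \<gamma> * c = 0" using 1 by (simp add: c_def)
    have u: "3 * u + \<alpha> + \<beta> * c + \<gamma> * c^2 = 0" by (simp add: u_def field_simps)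
    obtain H1 I1 J1 where "subst_equiv (cubic 1 0 0 0 \<alpha> \<beta> \<gamma> H I J) (?F 0 \<gamma> H1 I1 J1)"
      using subst_equiv_cubic_quadratic[of 1 1 0 c 1 0 0 0 1 0 0 0 u 0 \<alpha> \<beta> \<gamma> 0 0 \<gamma> H I J] c u
      by auto
    also have "subst_equiv (?F 0 \<gamma> H1 I1 J1) (?F 0 \<gamma> H1 0 (J1 - I1^2 / (4 * \<gamma>)))"
      by (rule subst_equiv_cubicI[where a = 1 and b = 0 and c = 0 and d = 1 and u = 0
            and v = "- I1 / (2 * \<gamma>)" and k = 1])
         (use 1 in \<open>simp_all add: field_simps power2_eq_square\<close>)
    also have "subst_equiv (?F 0 \<gamma> H1 0 (J1 - I1^2 / (4 * \<gamma>)))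
        (?F 0 (-1) (H1 / \<gamma>^2) 0 (- (J1 - I1^2 / (4 * \<gamma>)) / \<gamma>^3))"
      by (rule diag[of "- \<gamma>" "\<gamma>"]) (use 1 in \<open>simp_all add: power2_eq_square power3_eq_cube\<close>)
    finally show ?thesis using y2 by (meson subst_equiv_trans)
  next
    case 2
    \<comment> \<open>Each quantity clears one coefficient: \<open>u\<close> that of
      \<open>y\<close>, \<open>c\<close> that of \<open>x^2\<close>, \<open>v\<close> that of
      \<open>x\<close>. The constant term becomes \<open>J1\<close>.\<close>
    define u where "u = - I / \<beta>"
    define c where "c = - (3 * u + \<alpha>) / \<beta>"
    define v where "v = - (3 * u^2 + 2 * \<alpha> * u + H) / \<beta>"
    define J1 where "J1 = u^3 + \<alpha> * u^2 + \<beta> * u * v + H * u + I * v + J"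
    have uI: "\<beta> * u = - I" and cc: "\<beta> * c = - (3 * u + \<alpha>)"
      and vv: "\<beta> * v = - (3 * u^2 + 2 * \<alpha> * u + H)"
      using 2 by (simp_all add: u_def c_def v_def)
    have uc: "\<beta> * (c * u) = - (I * c)"
      using uI by (metis mult.assoc mult.commute minus_mult_left)
    have 1: "subst_equiv (cubic 1 0 0 0 \<alpha> \<beta> \<gamma> H I J) (?F (-1) 0 0 0 J1)"
      by (rule subst_equiv_cubicI[where a = 1 and b = 0 and c = c and d = "- 1 / \<beta>" and u = u
            and v = v and k = 1])
         (use 2 uI cc vv uc in \<open>simp_all add: J1_def algebra_simps\<close>)
    show ?thesis
    proof (cases "J1 = 0")
      case True
      show ?thesis by (intro exI conjI[rotated], rule 1) (use True in \<open>auto simp: nf4_def\<close>)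
    next
      case False
      obtain a where a: "a \<noteq> 0" "a^3 = J1" using exists_cube_root[OF False] .
      have "subst_equiv (?F (-1) 0 0 0 J1) (?F (-1) 0 0 0 1)"
        by (rule diag[of a "a^2"]) (use a in simp_all)
      from subst_equiv_trans[OF 1 this] show ?thesis by (intro exI conjI[rotated], assumption) (auto simp: nf4_def)
    qed
  next
    case 3
    then obtain H1 I1 J1 where 1: "subst_equiv (cubic 1 0 0 0 \<alpha> \<beta> \<gamma> H I J) (?F 0 0 H1 I1 J1)"
      using subst_equiv_translate[of 1 0 0 0 \<alpha> \<beta> \<gamma> H I J "- \<alpha> / 3" 0] by auto
    show ?thesis
    proof (cases "I1 = 0")
      case True
      then show ?thesis using x subst_equiv_trans[OF 1] by meson
    next
      case False
      \<comment> \<open>The new \<open>y\<close> is the negative of the whole affine part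
        \<open>H1 x + I1 y + J1\<close>.\<close>
      have "subst_equiv (?F 0 0 H1 I1 J1) (?F 0 0 0 (-1) 0)"
        by (rule subst_equiv_cubicI[where a = 1 and b = 0 and c = "- H1 / I1" and d = "- 1 / I1"
              and u = 0 and v = "- J1 / I1" and k = 1]) (use False in simp_all)
      from subst_equiv_trans[OF 1 this] show ?thesis by (intro exI conjI[rotated], assumption) (auto simp: nf4_def)
    qed
  qed
qed

section \<open>Inequivalence of the normal forms\<close>

text \<open>\<open>x (x^2 + y^2)\<close> vanishes on a single real line. A missing
  \<open>y^3\<close> term therefore means \<open>b = 0\<close>, and then the coefficients of
  \<open>x^3\<close> and \<open>x y^2\<close> cannot have opposite signs.\<close>

lemma leads_inequivalent_1_2:
  "\<not> subst_equiv (cubic 1 0 1 0 \<alpha> \<beta> \<gamma> H I J) (cubic 1 0 (-1) 0 \<alpha>' \<beta>' \<gamma>' H' I' J')"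
proof
  assume "subst_equiv (cubic 1 0 1 0 \<alpha> \<beta> \<gamma> H I J) (cubic 1 0 (-1) 0 \<alpha>' \<beta>' \<gamma>' H' I' J')"
  then obtain a b c d k :: real where det: "a * d - b * c \<noteq> 0"
    and e: "a^3 + a * c^2 = k" "3 * a^2 * b + (b * c^2 + 2 * a * c * d) = 0"
      "3 * a * b^2 + (a * d^2 + 2 * b * c * d) = - k" "b^3 + b * d^2 = 0"
    by (rule subst_equiv_cubicE) (simp del: power_eq_0_iff)
  have "b * (b^2 + d^2) = 0" using e(4) by (simp add: algebra_simps power2_eq_square power3_eq_cube)
  moreover have "b^2 + d^2 \<noteq> 0" using det by (auto simp: sum_power2_eq_zero_iff)
  ultimately have b: "b = 0" by (metis mult_eq_0_iff)
  have "a * (a^2 + c^2 + d^2) = 0"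
    using e(1,3) b by (simp add: algebra_simps power2_eq_square power3_eq_cube)
  moreover have "a \<noteq> 0" using det b by auto
  ultimately have "a^2 + c^2 + d^2 = 0" by simp
  moreover have "a^2 > 0" "c^2 \<ge> 0" "d^2 \<ge> 0" using \<open>a \<noteq> 0\<close> by simp_all
  ultimately show False by linarith
qed

text \<open>\<open>x^2 y\<close> vanishes on both axes, \<open>x (x^2 + y^2)\<close> on only one
  real line; both columns of the matrix would have to lie on it.\<close>

lemma leads_inequivalent_1_3:
  "\<not> subst_equiv (cubic 1 0 1 0 \<alpha> \<beta> \<gamma> H I J) (cubic 0 1 0 0 \<alpha>' \<beta>' \<gamma>' H' I' J')"
proof
  assume "subst_equiv (cubic 1 0 1 0 \<alpha> \<beta> \<gamma> H I J) (cubic 0 1 0 0 \<alpha>' \<beta>' \<gamma>' H' I' J')"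
  then obtain a b c d :: real where det: "a * d - b * c \<noteq> 0"
    and e: "a^3 + a * c^2 = 0" "b^3 + b * d^2 = 0"
    by (rule subst_equiv_cubicE) (simp del: power_eq_0_iff)
  have "a * (a^2 + c^2) = 0" "b * (b^2 + d^2) = 0"
    using e by (simp_all add: algebra_simps power2_eq_square power3_eq_cube)
  moreover have "a^2 + c^2 \<noteq> 0" "b^2 + d^2 \<noteq> 0" using det by (auto simp: sum_power2_eq_zero_iff)
  ultimately have "a = 0" "b = 0" by (metis mult_eq_0_iff)+
  then show False using det by simp
qed

text \<open>A linear substitution turns \<open>x^3\<close> into the cube
  \<open>(a x + b y)^3\<close>; without \<open>y^3\<close> it has no mixed terms either.\<close>

lemma leads_inequivalent_4:
  assumes "q \<noteq> 0 \<or> r \<noteq> 0"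
  shows "\<not> subst_equiv (cubic 1 0 0 0 \<alpha> \<beta> \<gamma> H I J) (cubic p q r 0 \<alpha>' \<beta>' \<gamma>' H' I' J')"
proof
  assume "subst_equiv (cubic 1 0 0 0 \<alpha> \<beta> \<gamma> H I J) (cubic p q r 0 \<alpha>' \<beta>' \<gamma>' H' I' J')"
  then obtain a b k :: real where "k \<noteq> 0" "3 * a^2 * b = k * q" "3 * a * b^2 = k * r" "b^3 = 0"
    by (rule subst_equiv_cubicE) (simp del: power_eq_0_iff)
  then show False using assms by simp
qed

text \<open>\<open>x^2 y\<close> has a repeated linear factor, whereas
  \<open>x (x - y) (x + y)\<close> has three different ones.\<close>

lemma leads_inequivalent_3_2:
  "\<not> subst_equiv (cubic 0 1 0 0 \<alpha> \<beta> \<gamma> H I J) (cubic 1 0 (-1) 0 \<alpha>' \<beta>' \<gamma>' H' I' J')"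
proof
  assume "subst_equiv (cubic 0 1 0 0 \<alpha> \<beta> \<gamma> H I J) (cubic 1 0 (-1) 0 \<alpha>' \<beta>' \<gamma>' H' I' J')"
  then obtain a b c d k :: real where "k \<noteq> 0"
    and e: "a^2 * c = k" "a^2 * d + 2 * a * b * c = 0" "b^2 * c + 2 * a * b * d = - k" "b^2 * d = 0"
    by (rule subst_equiv_cubicE) simp
  then show False by auto
qed

section \<open>Uniqueness within each family\<close>

lemma eq_if_pos_multiple:
  fixes x y t :: real
  assumes "x = t * y" "t > 0" "x \<in> {1, -1, 0}" "y \<in> {1, -1, 0}"
  shows "x = y"
  using assms by auto

text \<open>For the situation where a coefficient of even weight has forced \<open>a^2 = 1\<close>:
  what is left is the sign of the constant term, which the convention \<open>J \<ge> 0\<close>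
  settles.\<close>

lemma eq_if_nonneg_unit_cube_multiple:
  fixes x y a :: real
  assumes "x = a^3 * y" "a^2 = 1" "x \<ge> 0" "y \<ge> 0"
  shows "x = y"
proof -
  have "a = 1 \<or> a = -1" using assms(2) by (simp add: power2_eq_1_iff)
  then show ?thesis using assms by auto
qed

text \<open>The only real line of the form has to be preserved, which leads to
  \<open>b = c = 0\<close> and \<open>d = a\<close> or \<open>d = - a\<close>. As \<open>xy\<close>
  and \<open>y^2\<close> are absent on both sides, no translation is possible, and the weights of
  \<open>nf1_exists\<close> decide.\<close>

lemma nf1_unique:
  assumes "subst_equiv (cubic 1 0 1 0 \<alpha> 0 0 H I J) (cubic 1 0 1 0 \<alpha>' 0 0 H' I' J')"
    and "nf1 \<alpha> H I J" "nf1 \<alpha>' H' I' J'"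
  shows "\<alpha> = \<alpha>' \<and> H = H' \<and> I = I' \<and> J = J'"
proof -
  from assms(1) obtain a b u c d v k :: real where det: "a * d - b * c \<noteq> 0"
    and e: "a^3 + a * c^2 = k" "3 * a^2 * b + (b * c^2 + 2 * a * c * d) = 0"
      "3 * a * b^2 + (a * d^2 + 2 * b * c * d) = k" "b^3 + b * d^2 = 0"
      "3 * a^2 * u + (u * c^2 + 2 * a * c * v) + \<alpha> * a^2 = k * \<alpha>'"
      "6 * a * b * u + (2 * u * c * d + 2 * a * d * v + 2 * b * c * v) + 2 * \<alpha> * a * b = 0"
      "3 * b^2 * u + (u * d^2 + 2 * b * d * v) + \<alpha> * b^2 = 0"
      "3 * a * u^2 + (a * v^2 + 2 * u * c * v) + 2 * \<alpha> * a * u + H * a + I * c = k * H'"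
      "3 * b * u^2 + (b * v^2 + 2 * u * d * v) + 2 * \<alpha> * b * u + H * b + I * d = k * I'"
      "u^3 + u * v^2 + \<alpha> * u^2 + H * u + I * v + J = k * J'"
    by (rule subst_equiv_cubicE) (simp del: power_eq_0_iff)
  have "b * (b^2 + d^2) = 0" using e(4) by (simp add: algebra_simps power2_eq_square power3_eq_cube)
  moreover have "b^2 + d^2 \<noteq> 0" using det by (auto simp: sum_power2_eq_zero_iff)
  ultimately have b: "b = 0" by (metis mult_eq_0_iff)
  with det have a: "a \<noteq> 0" and d: "d \<noteq> 0" by auto
  have c: "c = 0" using e(2) a b d by simp
  have k: "k = a^3" using e(1) c by simp
  have "a * (d^2 - a^2) = 0" using e(3) b c k by (simp add: algebra_simps power2_eq_square power3_eq_cube)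
  then have "d^2 = a^2" using a by simp
  then have da: "d = a \<or> d = - a" by (simp add: power2_eq_iff)
  have v: "v = 0" using e(6) a b c d by simp
  have u: "u = 0" using e(7) b d by simp
  have "a * I = a * (a^2 * I') \<or> a * I = a * (- (a^2 * I'))"
    using e(9) da by (auto simp: b c k u v power2_eq_square power3_eq_cube algebra_simps)
  then have I: "I = a^2 * I' \<or> I = - (a^2 * I')"
    using a by (metis mult_left_cancel)
  have \<alpha>: "\<alpha> = a * \<alpha>'" and H: "H = a^2 * H'" and J: "J = a^3 * J'"
    using e(5,8,10) a by (auto simp: b c k u v power2_eq_square power3_eq_cube)
  have \<alpha>': "\<alpha> = \<alpha>'" using \<alpha> a assms(2,3) by (auto simp: nf1_def)
  have pos: "a^2 > 0" using a by simp
  show ?thesis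
  proof (cases "\<alpha> = 0")
    case False
    then have "\<alpha> = 1" "I \<ge> 0" "I' \<ge> 0" "a = 1" using \<alpha> \<alpha>' assms(2,3) by (auto simp: nf1_def)
    then show ?thesis using \<alpha>' H I J by auto
  next
    case True
    have II: "I = I'" using I a True \<alpha>' assms(2,3) by (auto simp: nf1_def)
    show ?thesis
    proof (cases "I = 0")
      case False
      then have "a^2 = 1 \<or> a^2 = -1" "J \<ge> 0" "J' \<ge> 0"
        using I True II \<alpha>' assms(2,3) by (auto simp: nf1_def)
      then have "a^2 = 1" "J \<ge> 0" "J' \<ge> 0" using pos by linarith+
      then show ?thesis using eq_if_nonneg_unit_cube_multiple[OF J] \<alpha>' H II by simp
    next
      case I0: True
      have HH: "H = H'"
        by (rule eq_if_pos_multiple[OF H pos])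
           (use True I0 II \<alpha>' assms(2,3) in \<open>auto simp: nf1_def\<close>)
      show ?thesis
      proof (cases "H = 0")
        case False
        then have "a^2 = 1" "J \<ge> 0" "J' \<ge> 0" using H True I0 II HH \<alpha>' assms(2,3) by (auto simp: nf1_def)
        then show ?thesis using eq_if_nonneg_unit_cube_multiple[OF J] \<alpha>' HH II by simp
      next
        case H0: True
        then show ?thesis using J a True I0 II HH \<alpha>' assms(2,3) by (auto simp: nf1_def)
      qed
    qed
  qed
qed

text \<open>The form is \<open>x (x - y) (x + y)\<close>: the first case fixes the line \<open>x = 0\<close>, the second one moves it.\<close>

lemma stabilizer_three_lines:
  fixes a b c d k :: real
  assumes det: "a * d - b * c \<noteq> 0"
    and e: "a^3 - a * c^2 = k" "3 * a^2 * b - (b * c^2 + 2 * a * c * d) = 0"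
      "3 * a * b^2 - (a * d^2 + 2 * b * c * d) = - k" "b^3 - b * d^2 = 0"
  obtains \<epsilon> where "\<epsilon> = 1 \<or> \<epsilon> = -1" "a \<noteq> 0" "b = 0" "c = 0" "d = \<epsilon> * a" "k = a^3"
  | \<epsilon> \<sigma> where "\<epsilon> = 1 \<or> \<epsilon> = -1" "\<sigma> = 1 \<or> \<sigma> = -1" "a \<noteq> 0" "b = \<sigma> * \<epsilon> * a" "c = - 3 * \<sigma> * a"
      "d = \<epsilon> * a" "k = - 8 * a^3"
proof (cases "b = 0")
  case True
  with det have ad: "a \<noteq> 0" "d \<noteq> 0" by auto
  have c: "c = 0" using e(2) ad True by simp
  have "a * (d^2 - a^2) = 0"
    using e(1,3) True c by (simp add: algebra_simps power2_eq_square power3_eq_cube)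
  then have "d = a \<or> d = - a" using ad by (simp add: power2_eq_iff)
  then have "d = (d / a) * a" "d / a = 1 \<or> d / a = - 1" using ad by auto
  then show thesis using that(1)[of "d / a"] ad True c e(1) by simp
next
  case False
  have "b * ((b - d) * (b + d)) = 0"
    using e(4) by (simp add: algebra_simps power2_eq_square power3_eq_cube)
  then have "b = d \<or> b = - d" using False by auto
  \<comment> \<open>The linear map sends the direction \<open>(0, 1)\<close> to
    \<open>(b, d)\<close>, so \<open>\<sigma>\<close> records which of the lines
    \<open>x = y\<close> and \<open>x = - y\<close> is the image of \<open>x = 0\<close>.\<close>
  then obtain \<sigma> where \<sigma>: "\<sigma> = 1 \<or> \<sigma> = -1" "b = \<sigma> * d" by (metis mult_1 mult_minus1)
  then have d: "d \<noteq> 0" using False by auto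
  have "a * d - \<sigma> * d * c = d * (a - \<sigma> * c)" by (simp add: algebra_simps)
  then have ac: "a - \<sigma> * c \<noteq> 0" using det \<sigma> by auto
  have "d * ((a - \<sigma> * c) * (3 * a + \<sigma> * c)) = 0"
    using e(2) \<sigma> by (auto simp: algebra_simps power2_eq_square)
  then have "3 * a + \<sigma> * c = 0" using d ac by simp
  then have c: "c = - 3 * \<sigma> * a" using \<sigma>(1) by auto
  then have a: "a \<noteq> 0" using ac by auto
  have k: "k = - 8 * a^3" using e(1) \<sigma>(1) by (auto simp: c power2_eq_square power3_eq_cube)
  have "8 * a * (d^2 - a^2) = 0"
    using e(3) \<sigma> by (auto simp: c k power2_eq_square power3_eq_cube algebra_simps)
  then have "d = a \<or> d = - a" using a by (simp add: power2_eq_iff)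
  then have "d = (d / a) * a" "d / a = 1 \<or> d / a = - 1" using a by auto
  then show thesis using that(2)[of "d / a" \<sigma>] a \<sigma> c k by simp
qed

text \<open>If the line \<open>x = 0\<close> is preserved, only scalings and
  \<open>y\<close>-reflections occur, as in \<open>nf1_unique\<close>. Otherwise a point of the
  chamber can stay in it only on a wall, where the parameters are again unchanged.\<close>

lemma nf2_unique:
  assumes "subst_equiv (cubic 1 0 (-1) 0 0 0 \<gamma> H I J) (cubic 1 0 (-1) 0 0 0 \<gamma>' H' I' J')"
    and "nf2 \<gamma> H I J" "nf2 \<gamma>' H' I' J'"
  shows "\<gamma> = \<gamma>' \<and> H = H' \<and> I = I' \<and> J = J'"
proof -
  from assms(1) obtain a b u c d v k :: real where det: "a * d - b * c \<noteq> 0"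
    and lead: "a^3 - a * c^2 = k" "3 * a^2 * b - (b * c^2 + 2 * a * c * d) = 0"
      "3 * a * b^2 - (a * d^2 + 2 * b * c * d) = - k" "b^3 - b * d^2 = 0"
    and e: "3 * a^2 * u - (u * c^2 + 2 * a * c * v) + \<gamma> * c^2 = 0"
      "6 * a * b * u - (2 * u * c * d + 2 * a * d * v + 2 * b * c * v) + 2 * \<gamma> * c * d = 0"
      "3 * b^2 * u - (u * d^2 + 2 * b * d * v) + \<gamma> * d^2 = k * \<gamma>'"
      "3 * a * u^2 - (a * v^2 + 2 * u * c * v) + 2 * \<gamma> * c * v + H * a + I * c = k * H'"
      "3 * b * u^2 - (b * v^2 + 2 * u * d * v) + 2 * \<gamma> * d * v + H * b + I * d = k * I'"
      "u^3 - u * v^2 + \<gamma> * v^2 + H * u + I * v + J = k * J'"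
    by (rule subst_equiv_cubicE) (simp add: algebra_simps del: power_eq_0_iff)
  from det lead show ?thesis
  proof (cases rule: stabilizer_three_lines)
    case (1 \<epsilon>)
    have u: "u = 0" using e(1) 1 by simp
    have v: "v = 0" using e(2) 1 by auto
    have "a^2 * \<gamma> = a^2 * (a * \<gamma>')" "a * H = a * (a^2 * H')" "a * I = a * (\<epsilon> * a^2 * I')"
      and J: "J = a^3 * J'"
      using e 1 by (auto simp: u v power2_eq_square power3_eq_cube)
    then have \<gamma>: "\<gamma> = a * \<gamma>'" and H: "H = a^2 * H'" and I: "I = \<epsilon> * a^2 * I'"
      using 1 by simp_all
    have pos: "a^2 > 0" using 1 by simp
    have \<gamma>': "\<gamma> = \<gamma>'" using \<gamma> 1(2) assms(2,3) by (auto simp: nf2_def)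
    show ?thesis
    proof (cases "\<gamma> = 0")
      case False
      then have "a = 1" "I \<ge> 0" "I' \<ge> 0" using \<gamma> \<gamma>' assms(2,3) by (auto simp: nf2_def)
      then show ?thesis using \<gamma>' H I J 1(1) by auto
    next
      case True
      have II: "I = I'" using I 1(1,2) True \<gamma>' assms(2,3) by (auto simp: nf2_def)
      show ?thesis
      proof (cases "I = 0")
        case False
        then have "a^2 = 1 \<or> a^2 = -1" "J \<ge> 0" "J' \<ge> 0"
          using I 1(1) True II \<gamma>' assms(2,3) by (auto simp: nf2_def)
        then have "a^2 = 1" "J \<ge> 0" "J' \<ge> 0" using pos by linarith+
        then show ?thesis using eq_if_nonneg_unit_cube_multiple[OF J] \<gamma>' H II by simp
      next
        case I0: True
        then show ?thesis using J 1(2) True II \<gamma>' assms(2,3) by (auto simp: nf2_def)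
      qed
    qed
  next
    case (2 \<epsilon> \<sigma>)
    \<comment> \<open>The absence of \<open>x^2\<close> and \<open>xy\<close> is a linear system
      that determines the translation; for \<open>\<gamma> = -1\<close> and
      \<open>\<sigma> = -1\<close> it is the translation of \<open>reflect1\<close>.\<close>
    have "a^2 * (- 6 * u + 6 * \<sigma> * v + 9 * \<gamma>) = 0"
      using e(1) 2(1,2) by (auto simp: 2(4-7) algebra_simps power2_eq_square)
    moreover have "a^2 * (12 * u + 4 * \<sigma> * v - 6 * \<gamma>) = 0"
      using e(2) 2(1,2) by (auto simp: 2(4-7) algebra_simps power2_eq_square)
    ultimately have "- 6 * u + 6 * \<sigma> * v + 9 * \<gamma> = 0" "12 * u + 4 * \<sigma> * v - 6 * \<gamma> = 0"
      using 2(3) by simp_all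
    then have uv: "u = 3 / 4 * \<gamma>" "v = - 3 / 4 * \<sigma> * \<gamma>"
      using 2(2) by auto
    have "a^2 * \<gamma> = a^2 * (- 2 * a * \<gamma>')"
      using e(3) 2(1,2) by (auto simp: uv 2(4-7) algebra_simps power2_eq_square power3_eq_cube)
    then have \<gamma>: "\<gamma> = - 2 * a * \<gamma>'" using 2(3) by (metis mult_left_cancel power_not_zero)
    have "nf2 \<gamma> H I J \<Longrightarrow> nf2 \<gamma>' H' I' J' \<Longrightarrow> (\<gamma> = 0 \<and> \<gamma>' = 0) \<or> (\<gamma> = -1 \<and> \<gamma>' = -1 \<and> a = - 1 / 2)"
      using \<gamma> 2(3) by (auto simp: nf2_def)
    then consider "\<gamma> = 0" "\<gamma>' = 0" | "\<gamma> = -1" "\<gamma>' = -1" "a = - 1 / 2" using assms by blast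
    then show ?thesis
    proof cases
      case A: 1
      have "a * (H - 3 * \<sigma> * I) = a * (- (8 * a^2) * H')" "a * (\<epsilon> * (\<sigma> * H + I)) = a * (- (8 * a^2) * I')"
        and J: "J = - 8 * a^3 * J'"
        using e(4-6) by (simp_all add: A uv 2(4-7) algebra_simps power2_eq_square power3_eq_cube)
      then have H: "H - 3 * \<sigma> * I = - (8 * a^2) * H'" and I: "\<epsilon> * (\<sigma> * H + I) = - (8 * a^2) * I'"
        using 2(3) by (metis mult_left_cancel)+
      have pos: "8 * a^2 > 0" using 2(3) by simp
      show ?thesis
      proof (cases "I = 0")
        case True
        then have "H = 0" using assms(2) A by (auto simp: nf2_def)
        then have "H' = 0" "I' = 0" using H I True 2(3) by auto
        then show ?thesis using J 2(3) True \<open>H = 0\<close> A assms(2,3) by (auto simp: nf2_def)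
      next
        case False
        then have I1: "I = -1" "\<bar>H\<bar> \<le> 1" "J \<ge> 0" using assms(2) A by (auto simp: nf2_def)
        have "I' \<noteq> 0" using H I1 2(2) A assms(3) by (auto simp: nf2_def)
        then have I2: "I' = -1" "\<bar>H'\<bar> \<le> 1" "J' \<ge> 0" using assms(3) A by (auto simp: nf2_def)
        \<comment> \<open>Absorbing the sign \<open>\<sigma>\<close> treats both images of
          \<open>x = 0\<close> at once. The equations then yield \<open>h + 3 \<le> 1 - h\<close>,
          so \<open>h = -1\<close>: the point lies on a wall, and \<open>a\<close> is
          \<open>1 / 2\<close> or \<open>- 1 / 2\<close>.\<close>
        define h h' where "h = \<sigma> * H" and "h' = \<sigma> * H'"
        have abs: "\<bar>h\<bar> \<le> 1" "\<bar>h'\<bar> \<le> 1" using I1 I2 2(2) by (auto simp: h_def h'_def)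
        have "\<epsilon> * (h - 1) = 8 * a^2" using I I1 I2 by (simp add: h_def)
        then have "h - 1 = 8 * a^2 \<or> 1 - h = 8 * a^2" using 2(1) by auto
        then have t: "1 - h = 8 * a^2" using pos abs by linarith
        have "h + 3 = - (8 * a^2 * h')" using H I1 2(2) by (auto simp: h_def h'_def)
        moreover have "8 * a^2 * (- h') \<le> 8 * a^2 * 1"
          by (rule mult_left_mono) (use abs pos in linarith)+
        ultimately have "h = -1" using t abs by linarith
        with t have a2: "8 * a^2 = 2" by simp
        have "h' = -1"
          using \<open>h + 3 = - (8 * a^2 * h')\<close> \<open>h = -1\<close> unfolding a2 by simp
        then have HH: "H = H'" using \<open>h = -1\<close> 2(2) by (auto simp: h_def h'_def)
        have "J = J'"
          by (rule eq_if_nonneg_unit_cube_multiple[of _ "- 2 * a"])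
             (use J a2 I1 I2 in \<open>simp_all add: power_mult_distrib\<close>)
        then show ?thesis using HH I1 I2 A by simp
      qed
    next
      case A: 2
      have "3 * \<sigma> * I - H - 3 / 4 = 2 * (H' + 3 / 4)"
        using e(4) 2(2) by (auto simp: uv 2(4-7) A(1,2)) (simp_all add: A(3) field_simps power2_eq_square power3_eq_cube)
      moreover have "- \<epsilon> * (\<sigma> * (H + 3 / 4) + I) = 2 * I'"
        using e(5) 2(1,2) by (auto simp: uv 2(4-7) A(1,2)) (simp_all add: A(3) field_simps power2_eq_square power3_eq_cube)
      moreover have "J' = J - 3 / 4 * H + 3 / 4 * \<sigma> * I - 9 / 16"
        using e(6) 2(2) by (auto simp: uv 2(4-7) A(1,2)) (simp_all add: A(3) field_simps power2_eq_square power3_eq_cube)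
      \<comment> \<open>In each of the four sign cases the inequalities leave only the wall
        \<open>H + I = - 3 / 4\<close> or its corner \<open>H = - 3 / 4\<close>,
        \<open>I = 0\<close>; there the equations give the same parameters back.\<close>
      ultimately show ?thesis
        using 2(1,2) assms(2,3) A unfolding nf2_def by auto
    qed
  qed
qed

text \<open>Both the double line and the simple line of \<open>x^2 y\<close> must be preserved, so
  the matrix is diagonal; the missing \<open>x^2\<close> and \<open>xy\<close> terms exclude
  translations. The cases follow which coefficients restrict the two scaling factors.\<close>

lemma nf3_unique:
  assumes "subst_equiv (cubic 0 1 0 0 0 0 \<gamma> H I J) (cubic 0 1 0 0 0 0 \<gamma>' H' I' J')"
    and "nf3 \<gamma> H I J" "nf3 \<gamma>' H' I' J'"
  shows "\<gamma> = \<gamma>' \<and> H = H' \<and> I = I' \<and> J = J'"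
proof -
  from assms(1) obtain a b u c d v k :: real where det: "a * d - b * c \<noteq> 0"
    and e: "a^2 * c = 0" "a^2 * d + 2 * a * b * c = k" "b^2 * c + 2 * a * b * d = 0" "b^2 * d = 0"
      "(a^2 * v + 2 * a * u * c) + \<gamma> * c^2 = 0"
      "(2 * a * b * v + 2 * a * u * d + 2 * b * u * c) + 2 * \<gamma> * c * d = 0"
      "(b^2 * v + 2 * b * u * d) + \<gamma> * d^2 = k * \<gamma>'"
      "(2 * a * u * v + u^2 * c) + 2 * \<gamma> * c * v + H * a + I * c = k * H'"
      "(2 * b * u * v + u^2 * d) + 2 * \<gamma> * d * v + H * b + I * d = k * I'"
      "u^2 * v + \<gamma> * v^2 + H * u + I * v + J = k * J'"
    by (rule subst_equiv_cubicE) simp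
  have b: "b = 0" using e(3,4) det by auto
  with det have a: "a \<noteq> 0" and d: "d \<noteq> 0" by auto
  have c: "c = 0" using e(1) a by simp
  have k: "k = a^2 * d" using e(2) c by simp
  have v: "v = 0" using e(5) a c by simp
  have u: "u = 0" using e(6) a b c d by simp
  have \<gamma>: "\<gamma> * d = a^2 * \<gamma>'" and H: "H = a * d * H'" and I: "I = a^2 * I'" and J: "J = a^2 * d * J'"
    using e(7-10) a d by (auto simp: b c k u v power2_eq_square)
  have \<gamma>': "\<gamma> = \<gamma>'" and H': "H = H'"
    using \<gamma> H a d assms(2,3) by (auto simp: nf3_def)
  have pos: "a^2 > 0" using a by simp
  note I' = eq_if_pos_multiple[OF I pos]
  consider "\<gamma> = 1" "H = -1" | "\<gamma> = 1" "H = 0" | "\<gamma> = 0" "H = -1" "I \<noteq> 0" | "\<gamma> = 0" "H = -1" "I = 0"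
    | "\<gamma> = 0" "H = 0"
    using assms(2) by (auto simp: nf3_def)
  then show ?thesis
  proof cases
    case 1
    then have "d = a^2" "a * d = 1" using \<gamma> H \<gamma>' H' by auto
    \<comment> \<open>Here \<open>H\<close> has the odd weight 3, so \<open>a = 1\<close> and no
      freedom remains: \<open>I\<close> and \<open>J\<close> are invariants without sign
      conditions.\<close>
    then have "a^3 = 1" by (simp add: power2_eq_square power3_eq_cube)
    then have "a = 1" using odd_real_root_power_cancel[of 3 a] by simp
    then show ?thesis using \<open>d = a^2\<close> \<gamma>' H' I J by simp
  next
    case 2
    then have d: "d = a^2" using \<gamma> \<gamma>' by auto
    have I2: "I = I'"
      by (rule I') (use 2 \<gamma>' H' assms(2,3) in \<open>auto simp: nf3_def\<close>)
    show ?thesis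
    proof (cases "I = 0")
      case True
      have "J = J'"
        by (rule eq_if_pos_multiple[of _ "a^2 * a^2"])
           (use J d pos 2 True I2 \<gamma>' H' assms(2,3) in \<open>auto simp: nf3_def\<close>)
      then show ?thesis using I2 \<gamma>' H' by simp
    next
      case False
      then have "a^2 = 1" using I I2 by auto
      then show ?thesis using I2 \<gamma>' H' J d by simp
    qed
  next
    case 3
    then have "a * d = 1" using H H' by simp
    have I2: "I = I'"
      by (rule I') (use 3 \<gamma>' H' assms(2,3) in \<open>auto simp: nf3_def\<close>)
    then have "a^2 = 1" using 3 I by auto
    then have "a = 1 \<or> a = -1" by (simp add: power2_eq_1_iff)
    moreover have "J \<ge> 0" "J' \<ge> 0" using assms(2,3) 3 \<gamma>' H' I2 by (auto simp: nf3_def)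
    ultimately show ?thesis using J \<open>a * d = 1\<close> I2 \<gamma>' H' by auto
  next
    case 4
    then show ?thesis using I J a d \<gamma>' H' assms(2,3) by (auto simp: nf3_def)
  next
    case 5
    have I2: "I = I'"
      by (rule I') (use 5 \<gamma>' H' assms(2,3) in \<open>auto simp: nf3_def\<close>)
    then show ?thesis using J a d 5 \<gamma>' H' assms(2,3) by (auto simp: nf3_def)
  qed
qed

text \<open>The cubic part yields only \<open>b = 0\<close> and \<open>k = a^3\<close>; shears and
  translations survive. Whether they are trivial depends on the lower terms: if \<open>y\<close>
  does not occur, \<open>c\<close> and \<open>v\<close> stay arbitrary but do not affect the
  coefficients.\<close>

lemma nf4_unique:
  assumes "subst_equiv (cubic 1 0 0 0 0 \<beta> \<gamma> H I J) (cubic 1 0 0 0 0 \<beta>' \<gamma>' H' I' J')"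
    and "nf4 \<beta> \<gamma> H I J" "nf4 \<beta>' \<gamma>' H' I' J'"
  shows "\<beta> = \<beta>' \<and> \<gamma> = \<gamma>' \<and> H = H' \<and> I = I' \<and> J = J'"
proof -
  from assms(1) obtain a b u c d v k :: real where det: "a * d - b * c \<noteq> 0"
    and e: "a^3 = k" "b^3 = 0"
      "3 * a^2 * u + \<beta> * a * c + \<gamma> * c^2 = 0"
      "6 * a * b * u + \<beta> * (a * d + b * c) + 2 * \<gamma> * c * d = k * \<beta>'"
      "3 * b^2 * u + \<beta> * b * d + \<gamma> * d^2 = k * \<gamma>'"
      "3 * a * u^2 + \<beta> * (a * v + u * c) + 2 * \<gamma> * c * v + H * a + I * c = k * H'"
      "3 * b * u^2 + \<beta> * (b * v + u * d) + 2 * \<gamma> * d * v + H * b + I * d = k * I'"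
      "u^3 + \<beta> * u * v + \<gamma> * v^2 + H * u + I * v + J = k * J'"
    by (rule subst_equiv_cubicE) (simp del: power_eq_0_iff)
  have b: "b = 0" using e(2) by simp
  with det have a: "a \<noteq> 0" and d: "d \<noteq> 0" by auto
  have k: "k = a^3" using e(1) by simp
  have pos: "a^2 > 0" using a by simp
  have \<gamma>: "\<gamma> = \<gamma>'"
    using e(5) a d assms(2,3) by (auto simp: nf4_def b k)
  consider "\<gamma> = -1" | "\<gamma> = 0" "\<beta> = -1" | "\<gamma> = 0" "\<beta> = 0" "I = 0" | "\<gamma> = 0" "\<beta> = 0" "I \<noteq> 0"
    using assms(2) by (auto simp: nf4_def)
  then show ?thesis
  proof cases
    case 1
    then have z: "\<beta> = 0" "\<beta>' = 0" "I = 0" "I' = 0"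
      using assms(2,3) \<gamma> by (auto simp: nf4_def)
    have c: "c = 0" using e(4) b d 1 z by simp
    have u: "u = 0" using e(3) a c z by simp
    have v: "v = 0" using e(7) b d 1 z by simp
    have "d^2 = a^3" using e(5) 1 \<gamma> by (simp add: b k z)
    moreover have "d^2 > 0" using d by simp
    \<comment> \<open>Thus \<open>a\<close> is positive and the sign of \<open>J\<close> is an
      invariant, in contrast to the cubics in \<open>x\<close> alone.\<close>
    ultimately have "a > 0" by (simp add: zero_less_power_eq)
    have H: "H = a^2 * H'" using e(6) a by (auto simp: c u v z k power2_eq_square power3_eq_cube)
    have J: "J = a^3 * J'" using e(8) by (simp add: u v k)
    have HH: "H = H'"
      by (rule eq_if_pos_multiple[OF H pos]) (use 1 \<gamma> assms(2,3) in \<open>auto simp: nf4_def\<close>)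
    show ?thesis
    proof (cases "H = 0")
      case True
      have "J = J'"
        by (rule eq_if_pos_multiple[OF J]) (use True HH \<open>a > 0\<close> 1 \<gamma> assms(2,3) in \<open>auto simp: nf4_def\<close>)
      then show ?thesis using z \<gamma> HH by simp
    next
      case False
      then have "a^2 = 1" using H HH by auto
      then have "a = 1" using \<open>a > 0\<close> by (simp add: power2_eq_1_iff)
      then show ?thesis using z \<gamma> HH J by simp
    qed
  next
    case 2
    then have "\<beta>' \<noteq> 0" using e(4) a d \<gamma> by (auto simp: b)
    then have z: "\<beta>' = -1" "I = 0" "I' = 0" "H = 0" "H' = 0"
      using assms(2,3) 2 by (auto simp: nf4_def)
    have u: "u = 0" using e(7) 2 d by (simp add: b z)
    have c: "c = 0" using e(3) 2 a by (simp add: u)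
    have v: "v = 0" using e(6) 2 a by (simp add: u c z)
    have "J = a^3 * J'" using e(8) by (simp add: u v k)
    then show ?thesis using 2 z \<gamma> a assms(2,3) by (auto simp: nf4_def)
  next
    case 3
    have u: "u = 0" using e(3) 3 a by simp
    have I': "I' = 0" using e(7) 3 a by (simp add: b k)
    have \<beta>': "\<beta>' = 0" using e(4) 3 a by (simp add: b k)
    have H: "H = a^2 * H'" using e(6) 3 a by (auto simp: u k power2_eq_square power3_eq_cube)
    have J: "J = a^3 * J'" using e(8) 3 by (simp add: u k)
    have HH: "H = H'"
      by (rule eq_if_pos_multiple[OF H pos]) (use 3 \<gamma> I' \<beta>' assms(2,3) in \<open>auto simp: nf4_def\<close>)
    show ?thesis
    proof (cases "H = 0")
      case True
      then show ?thesis using J a HH 3 \<gamma> I' \<beta>' assms(2,3) by (auto simp: nf4_def)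
    next
      case False
      then have "a^2 = 1" using H HH by auto
      then have "a = 1 \<or> a = -1" by (simp add: power2_eq_1_iff)
      moreover have "J \<ge> 0" "J' \<ge> 0" using False HH 3 \<gamma> I' \<beta>' assms(2,3) by (auto simp: nf4_def)
      ultimately show ?thesis using J HH 3 \<gamma> I' \<beta>' by auto
    qed
  next
    case 4
    then have "I' \<noteq> 0" "\<beta>' = 0" using e(4,7) a d by (auto simp: b)
    then show ?thesis using 4 \<gamma> assms(2,3) by (auto simp: nf4_def)
  qed
qed

section \<open>Comparison with the list\<close>

definition cubic_poly :: "real \<Rightarrow> real \<Rightarrow> real \<Rightarrow> real \<Rightarrow> real \<Rightarrow> real \<Rightarrow> real \<Rightarrow> real \<Rightarrow> real \<Rightarrow> real
    \<Rightarrow> bipoly" where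
  "cubic_poly p q r s \<alpha> \<beta> \<gamma> H I J =
     PC p * PX^3 + PC q * PX^2 * PY + PC r * PX * PY^2 + PC s * PY^3 +
     PC \<alpha> * PX^2 + PC \<beta> * PX * PY + PC \<gamma> * PY^2 + PC H * PX + PC I * PY + PC J"

lemma eval2_cubic_poly: "eval2 (cubic_poly p q r s \<alpha> \<beta> \<gamma> H I J) = cubic p q r s \<alpha> \<beta> \<gamma> H I J"
  by (simp add: fun_eq_iff cubic_poly_def cubic_def)

text \<open>Some list entries are syntactic initial segments of others, so the rewriting to \<open>cubic_poly\<close>
  has to proceed in stages, longest entries first.\<close>

lemma L1_eq: "L1 = {cubic_poly 1 0 1 0 \<alpha> 0 0 H I J | \<alpha> H I J. nf1 \<alpha> H I J}"
proof -
  have eqs: "PX^3 + PX * PY^2 + PX^2 + PC H * PX + PC I * PY + PC J = cubic_poly 1 0 1 0 1 0 0 H I J"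
    "PX^3 + PX * PY^2 + PY + PC H * PX + PC J = cubic_poly 1 0 1 0 0 0 0 H 1 J"
    "PX^3 + PX * PY^2 + PC H * PX + PC J = cubic_poly 1 0 1 0 0 0 0 H 0 J"
    "PX^3 + PX * PY^2 + 1 = cubic_poly 1 0 1 0 0 0 0 0 0 1" for H I J
    by (simp_all add: cubic_poly_def PC_hom)
  have base: "PX^3 + PX * PY^2 = cubic_poly 1 0 1 0 0 0 0 0 0 0"
    by (simp add: cubic_poly_def PC_hom)
  show ?thesis
    unfolding L1_def unfolding eqs unfolding base unfolding nf1_def by blast
qed

lemma L2_eq: "L2 = {cubic_poly 1 0 (-1) 0 0 0 \<gamma> H I J | \<gamma> H I J. nf2 \<gamma> H I J}"
proof -
  have eqs: "PX^3 - PX * PY^2 - PY^2 + PC H * PX + PC I * PY + PC J = cubic_poly 1 0 (-1) 0 0 0 (-1) H I J"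
    "PX^3 - PX * PY^2 - PY + PC H * PX + PC J = cubic_poly 1 0 (-1) 0 0 0 0 H (-1) J"
    "PX^3 - PX * PY^2 + 1 = cubic_poly 1 0 (-1) 0 0 0 0 0 0 1" for H I J
    by (simp_all add: cubic_poly_def PC_hom)
  have base: "PX^3 - PX * PY^2 = cubic_poly 1 0 (-1) 0 0 0 0 0 0 0"
    by (simp add: cubic_poly_def PC_hom)
  show ?thesis
    unfolding L2_def unfolding eqs unfolding base unfolding nf2_def by blast
qed

lemma L3_eq: "L3 = {cubic_poly 0 1 0 0 0 0 \<gamma> H I J | \<gamma> H I J. nf3 \<gamma> H I J}"
proof -
  have eqs: "PX^2 * PY + PY^2 - PX + PC I * PY + PC J = cubic_poly 0 1 0 0 0 0 1 (-1) I J"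
    "PX^2 * PY + PY^2 + PC I * PY + PC J = cubic_poly 0 1 0 0 0 0 1 0 I J"
    "PX^2 * PY + PY^2 + PC J = cubic_poly 0 1 0 0 0 0 1 0 0 J"
    "PX^2 * PY - PX + PC I * PY + PC J = cubic_poly 0 1 0 0 0 0 0 (-1) I J"
    "PX^2 * PY + PC I * PY + 1 = cubic_poly 0 1 0 0 0 0 0 0 I 1"
    "PX^2 * PY - PX + 1 = cubic_poly 0 1 0 0 0 0 0 (-1) 0 1"
    "PX^2 * PY - 1 = cubic_poly 0 1 0 0 0 0 0 0 0 (-1)" for I J
    by (simp_all add: cubic_poly_def PC_hom)
  have prefixes: "PX^2 * PY + PY^2 = cubic_poly 0 1 0 0 0 0 1 0 0 0"
    "PX^2 * PY + PC I * PY = cubic_poly 0 1 0 0 0 0 0 0 I 0"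
    "PX^2 * PY - PX = cubic_poly 0 1 0 0 0 0 0 (-1) 0 0" for I
    by (simp_all add: cubic_poly_def PC_hom)
  have base: "PX^2 * PY = cubic_poly 0 1 0 0 0 0 0 0 0 0"
    by (simp add: cubic_poly_def PC_hom)
  show ?thesis
    unfolding L3_def unfolding eqs unfolding prefixes unfolding base unfolding nf3_def by blast
qed

lemma L4_eq: "L4 = {cubic_poly 1 0 0 0 0 \<beta> \<gamma> H I J | \<beta> \<gamma> H I J. nf4 \<beta> \<gamma> H I J}"
proof -
  have eqs: "PX^3 - PY^2 + PC H * PX + PC J = cubic_poly 1 0 0 0 0 0 (-1) H 0 J"
    "PX^3 - PY^2 + PC J = cubic_poly 1 0 0 0 0 0 (-1) 0 0 J"
    "PX^3 - PY = cubic_poly 1 0 0 0 0 0 0 0 (-1) 0"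
    "PX^3 - PX * PY + 1 = cubic_poly 1 0 0 0 0 (-1) 0 0 0 1"
    "PX^3 + PC H * PX + PC J = cubic_poly 1 0 0 0 0 0 0 H 0 J"
    "PX^3 + 1 = cubic_poly 1 0 0 0 0 0 0 0 0 1" for H J
    by (simp_all add: cubic_poly_def PC_hom)
  have prefixes: "PX^3 - PY^2 = cubic_poly 1 0 0 0 0 0 (-1) 0 0 0"
    "PX^3 - PX * PY = cubic_poly 1 0 0 0 0 (-1) 0 0 0 0"
    by (simp_all add: cubic_poly_def PC_hom)
  have base: "PX^3 = cubic_poly 1 0 0 0 0 0 0 0 0 0"
    by (simp add: cubic_poly_def PC_hom)
  show ?thesis
    unfolding L4_def unfolding eqs unfolding prefixes unfolding base unfolding nf4_def by blast
qed

lemma equivalent_to_cubic_list: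
  assumes "total_degree f = 3"
  shows "\<exists>g\<in>cubic_list. affine_equiv f g"
proof -
  obtain p q r s \<alpha> \<beta> \<gamma> H I J where
    f: "eval2 f = cubic p q r s \<alpha> \<beta> \<gamma> H I J" and nz: "p \<noteq> 0 \<or> q \<noteq> 0 \<or> r \<noteq> 0 \<or> s \<noteq> 0"
    using total_degree_three_cubic[OF assms] .
  obtain p' q' r' s' \<alpha>' \<beta>' \<gamma>' H' I' J' where lead: "(p', q', r', s') \<in> canonical_leads"
    and 1: "subst_equiv (eval2 f) (cubic p' q' r' s' \<alpha>' \<beta>' \<gamma>' H' I' J')"
    using reducible_lead_nonzero[OF nz, unfolded reducible_lead_def, rule_format, of \<alpha> \<beta> \<gamma> H I J]
    unfolding f by blast
  have "\<exists>g\<in>cubic_list. subst_equiv (cubic p' q' r' s' \<alpha>' \<beta>' \<gamma>' H' I' J') (eval2 g)"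
    using lead unfolding canonical_leads_def
  proof (elim insertE emptyE; clarsimp)
    show "\<exists>g\<in>cubic_list. subst_equiv (cubic 1 0 1 0 \<alpha>' \<beta>' \<gamma>' H' I' J') (eval2 g)"
      using nf1_exists[of \<alpha>' \<beta>' \<gamma>' H' I' J'] unfolding cubic_list_def L1_eq eval2_cubic_poly[symmetric]
      by blast
    show "\<exists>g\<in>cubic_list. subst_equiv (cubic 1 0 (-1) 0 \<alpha>' \<beta>' \<gamma>' H' I' J') (eval2 g)"
      using nf2_exists[of \<alpha>' \<beta>' \<gamma>' H' I' J'] unfolding cubic_list_def L2_eq eval2_cubic_poly[symmetric]
      by blast
    show "\<exists>g\<in>cubic_list. subst_equiv (cubic 0 1 0 0 \<alpha>' \<beta>' \<gamma>' H' I' J') (eval2 g)"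
      using nf3_exists[of \<alpha>' \<beta>' \<gamma>' H' I' J'] unfolding cubic_list_def L3_eq eval2_cubic_poly[symmetric]
      by blast
    show "\<exists>g\<in>cubic_list. subst_equiv (cubic 1 0 0 0 \<alpha>' \<beta>' \<gamma>' H' I' J') (eval2 g)"
      using nf4_exists[of \<alpha>' \<beta>' \<gamma>' H' I' J'] unfolding cubic_list_def L4_eq eval2_cubic_poly[symmetric]
      by blast
  qed
  then show ?thesis
    using subst_equiv_trans[OF 1] by (auto simp: affine_equiv_iff)
qed

lemma cubic_list_inequivalent:
  assumes "f \<in> cubic_list" "g \<in> cubic_list" "affine_equiv f g"
  shows "f = g"
proof -
  have fg: "subst_equiv (eval2 f) (eval2 g)" and gf: "subst_equiv (eval2 g) (eval2 f)"
    using assms(3) subst_equiv_sym by (simp_all add: affine_equiv_iff)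
  \<comment> \<open>Each pair of families is covered in one direction only; applying this to both
    \<open>fg\<close> and \<open>gf\<close> gives the other. The three instances of
    \<open>leads_inequivalent_4\<close> are the cubic parts of \<open>L1\<close>, \<open>L2\<close>
    and \<open>L3\<close>.\<close>
  have cross: "False" if "subst_equiv (eval2 f) (eval2 g)"
    "f \<in> L1 \<and> g \<in> L2 \<or> f \<in> L1 \<and> g \<in> L3 \<or> f \<in> L3 \<and> g \<in> L2 \<or> f \<in> L4 \<and> g \<in> L1 \<union> L2 \<union> L3" for f g
    using that leads_inequivalent_1_2 leads_inequivalent_1_3 leads_inequivalent_3_2
      leads_inequivalent_4[of 0 1] leads_inequivalent_4[of 0 "-1"] leads_inequivalent_4[of 1 0]
    unfolding L1_eq L2_eq L3_eq L4_eq by (auto simp: eval2_cubic_poly)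
  have "f \<in> L1 \<and> g \<in> L1 \<or> f \<in> L2 \<and> g \<in> L2 \<or> f \<in> L3 \<and> g \<in> L3 \<or> f \<in> L4 \<and> g \<in> L4"
    using assms(1,2) cross[OF fg] cross[OF gf] unfolding cubic_list_def by blast
  then show ?thesis
  proof (elim disjE conjE)
    assume "f \<in> L1" "g \<in> L1"
    then show ?thesis using fg nf1_unique unfolding L1_eq by (force simp: eval2_cubic_poly)
  next
    assume "f \<in> L2" "g \<in> L2"
    then show ?thesis using fg nf2_unique unfolding L2_eq by (force simp: eval2_cubic_poly)
  next
    assume "f \<in> L3" "g \<in> L3"
    then show ?thesis using fg nf3_unique unfolding L3_eq by (force simp: eval2_cubic_poly)
  next
    assume "f \<in> L4" "g \<in> L4"
    then show ?thesis using fg nf4_unique unfolding L4_eq by (force simp: eval2_cubic_poly)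
  qed
qed

theorem theorem1p10:
  shows "(\<forall>f :: bipoly. total_degree f = 3 \<longrightarrow> (\<exists>g\<in>cubic_list. affine_equiv f g)) \<and>
         (\<forall>f\<in>cubic_list. \<forall>g\<in>cubic_list. f \<noteq> g \<longrightarrow> \<not> affine_equiv f g)"
  using equivalent_to_cubic_list cubic_list_inequivalent by blast

end
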